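(* Let $L$ be a finite modular semilattice, $\mathcal{F}=\mathcal{C}(P(L))\subseteq 2^{L^{\mathrm{ir}}}$, and $c$ the closure operator of $\mathcal{F}$. The pseudoclosed sets of $\mathcal{F}$ are exactly the following subsets: (a) $\{q\}$ for every nonatomic $q\in L^{\mathrm{ir}}$; (b) $\phi(x_i)\cup\phi(x_j)$ for every $\mathcal{M}_n$-element $x\in L$ with intermediate elements $x_0,\dots,x_{n-1}$ and every $0\le i<j\le n-1$; (c) $c^\bullet(\phi(x)\cup\phi(y))$ for every minimal inconsistent pair $(x,y)$ in $L^{\mathrm{ir}}$.
   Context: Semilattices are meet-semilattices; joins may not exist. A semilattice is modular if both of the following hold: every principal ideal is a modular lattice; and $x\vee y\vee z$ exists whenever the pairwise joins exist. An element is $\vee$-irreducible if it is not the minimum and $l=a\vee b$ implies $l=a$ or $l=b$. $L^{\mathrm{ir}}$ is the set of $\vee$-irreducible elements of $L$, and $\phi(l)=\{p\in L^{\mathrm{ir}}\mid p\le l\}$. Induced relations on $L^{\mathrm{ir}}$: - $x\smile y$ iff $x\vee y$ does not exist; - $C(x,y,z)$ iff $x,y,z$ are pairwise incomparable, the pairwise joins exist, and they are equal. $\mathcal{C}(P(L))$ is the family of subsets $X\subseteq L^{\mathrm{ir}}$ satisfying all three of the following (equivalently, $\mathcal{C}(P(L))=\{\phi(l)\mid l\in L\}$): - $X$ is down-closed; - $X$ contains no pair $p\smile q$; - $p,q\in X$ and $C(p,q,r)$ imply $r\in X$. Covers and special elements: - Each $q\in L^{\mathrm{ir}}$ has a unique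 lower cover $\underline q$; $q$ is nonatomic if $\underline q\ne\min L$. - $l$ is an $\mathcal{M}_n$-element ($n\ge3$) if there are $y,x_0,\dots,x_{n-1}$ with $y\prec x_i\prec l$ (covering relations), $x_i\wedge x_j=y$ and $x_i\vee x_j=l$ for all distinct $i,j$; the $x_i$ are the intermediate elements. - $(x,y)$ is a minimal inconsistent pair if $x\vee y$ does not exist, and whenever $x'\le x$, $y'\le y$ in $L^{\mathrm{ir}}$ and $x'\vee y'$ does not exist, we have $x'=x$ and $y'=y$. Closure notions for a $\cap$-closed family $\mathcal{F}$ on a finite set $E$: - $c(X)=\bigcap\{F\in\mathcal{F}\mid X\subseteq F\}$, undefined if no such $F$ exists. - $X\subseteq E$ is quasiclosed if either - $c(X)$ exists, and every $Y\subseteq X$ with $c(Y)\neq c(X)$ satisfies $c(Y)\subseteq X$; or - $c(X)$ does not exist, and every $Y\subseteq X$ for which $c(Y)$ exists satisfies $c(Y)\subseteq X$. - $c^\bullet(X)$ is the smallest quasiclosed set containing $X$. - $X$ is properly quasiclosed if it is quasiclosed but not in $\mathcal{F}$. - The images of $X$ and $Y$ under $c$ are equivalent if either both exist and $c(X)=c(Y)$, or neither exists. - A properly quasiclosed set $P$ is pseudoclosed if it is inclusion-minimal among the properly quasiclosed sets whose image under $c$ is equivalent to that of $P$.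
   Formalization: In (b), an M_n-element is additionally required to have its intermediate elements x_0,…,x_{n-1} be all of its lower covers; without this the claim fails, e.g. for the top of M_3 × {0<1} with y=(0,1). *)

theory Defs
  imports "HOL-Library.Lub_Glb"
begin

text \<open>
  Joins are partial in a meet-semilattice, so they are treated relationally:
  \<open>isLub A {x, y} s\<close> says that \<open>s\<close> is the join of \<open>x\<close> and \<open>y\<close> inside the subposet \<open>A\<close>,
  and \<open>isLub UNIV {x, y} s\<close> is the join in the whole semilattice.
\<close>

definition has_join :: "'a::order \<Rightarrow> 'a \<Rightarrow> bool" where
  "has_join x y \<longleftrightarrow> (\<exists>s. isLub UNIV {x, y} s)"

definition lattice_on :: "'a::order set \<Rightarrow> bool" where
  "lattice_on A \<longleftrightarrow> (\<forall>x\<in>A. \<forall>y\<in>A. (\<exists>s. isLub A {x, y} s) \<and> (\<exists>m. isGlb A {x, y} m))"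

text \<open>The modular law is \<open>x \<le> z \<Longrightarrow> x \<squnion> (y \<sqinter> z) = (x \<squnion> y) \<sqinter> z\<close>, all operations taken in \<open>A\<close>.\<close>

definition modular_lattice_on :: "'a::order set \<Rightarrow> bool" where
  "modular_lattice_on A \<longleftrightarrow> lattice_on A \<and>
     (\<forall>x\<in>A. \<forall>y\<in>A. \<forall>z\<in>A. x \<le> z \<longrightarrow>
        (\<forall>yz xy l r. isGlb A {y, z} yz \<longrightarrow> isLub A {x, yz} l \<longrightarrow>
                     isLub A {x, y} xy \<longrightarrow> isGlb A {xy, z} r \<longrightarrow> l = r))"

definition modular_semilattice :: "'a::semilattice_inf itself \<Rightarrow> bool" where
  "modular_semilattice _ \<longleftrightarrow>
     (\<forall>a::'a. modular_lattice_on {..a}) \<and>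
     (\<forall>x y z::'a. has_join x y \<longrightarrow> has_join y z \<longrightarrow> has_join x z \<longrightarrow>
        (\<exists>s. isLub UNIV {x, y, z} s))"

definition is_minimum :: "'a::order \<Rightarrow> bool" where
  "is_minimum x \<longleftrightarrow> (\<forall>z. x \<le> z)"

definition join_irreducible :: "'a::order \<Rightarrow> bool" where
  "join_irreducible l \<longleftrightarrow>
     \<not> is_minimum l \<and> (\<forall>a b. isLub UNIV {a, b} l \<longrightarrow> l = a \<or> l = b)"

definition Lir :: "'a::order set" where
  "Lir = {p. join_irreducible p}"

definition \<phi> :: "'a::order \<Rightarrow> 'a set" where
  "\<phi> l = {p \<in> Lir. p \<le> l}"

definition inconsistent :: "'a::order \<Rightarrow> 'a \<Rightarrow> bool" where
  "inconsistent x y \<longleftrightarrow> \<not> has_join x y"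

definition incomparable :: "'a::order \<Rightarrow> 'a \<Rightarrow> bool" where
  "incomparable x y \<longleftrightarrow> \<not> x \<le> y \<and> \<not> y \<le> x"

definition collinear :: "'a::order \<Rightarrow> 'a \<Rightarrow> 'a \<Rightarrow> bool" where
  "collinear x y z \<longleftrightarrow>
     incomparable x y \<and> incomparable y z \<and> incomparable x z \<and>
     (\<exists>s. isLub UNIV {x, y} s \<and> isLub UNIV {y, z} s \<and> isLub UNIV {x, z} s)"

text \<open>The family \<open>\<C>(P(L))\<close>; \<open>inconsistent\<close> is \<open>\<smile>\<close> and \<open>collinear\<close> is \<open>C\<close>,
  both restricted to \<open>Lir\<close> here.\<close>

definition consistent_subspaces :: "'a::order set set" where
  "consistent_subspaces =
     {X. X \<subseteq> Lir \<and>
         (\<forall>p\<in>X. \<forall>q\<in>Lir. q \<le> p \<longrightarrow> q \<in> X) \<and>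
         (\<forall>p\<in>X. \<forall>q\<in>X. \<not> inconsistent p q) \<and>
         (\<forall>p\<in>X. \<forall>q\<in>X. \<forall>r\<in>Lir. collinear p q r \<longrightarrow> r \<in> X)}"

definition covered_by :: "'a::order \<Rightarrow> 'a \<Rightarrow> bool" (infix \<open>\<prec>\<close> 50) where
  "a \<prec> b \<longleftrightarrow> a < b \<and> \<not> (\<exists>z. a < z \<and> z < b)"

definition lower_cover :: "'a::order \<Rightarrow> 'a" where
  "lower_cover q = (THE a. a \<prec> q)"

definition nonatomic :: "'a::order \<Rightarrow> bool" where
  "nonatomic q \<longleftrightarrow> \<not> is_minimum (lower_cover q)"

text \<open>
  \<open>M_element n l x\<close>: \<open>l\<close> is an \<open>\<M>\<^sub>n\<close>-element with intermediate elements \<open>x 0, \<dots>, x (n - 1)\<close>.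
  The last conjunct says that the intermediate elements are all the lower covers of \<open>l\<close>.
  It cannot be dropped. In the product of the five-element lattice with atoms \<open>p, q, r\<close> and the
  chain \<open>0 < 1\<close>, the top satisfies the other conjuncts with \<open>y = (0, 1)\<close> and the intermediate
  elements \<open>(p, 1), (q, 1), (r, 1)\<close>, but \<open>\<phi> (p, 1) \<union> \<phi> (q, 1) = {(p, 0), (q, 0), (0, 1)}\<close> is not
  quasiclosed, since it does not contain the closure \<open>{(p, 0), (q, 0), (r, 0)}\<close> of
  \<open>{(p, 0), (q, 0)}\<close>.
\<close>

definition M_element :: "nat \<Rightarrow> 'a::semilattice_inf \<Rightarrow> (nat \<Rightarrow> 'a) \<Rightarrow> bool" where
  "M_element n l x \<longleftrightarrow> 3 \<le> n \<and>
     (\<exists>y. (\<forall>i<n. y \<prec> x i \<and> x i \<prec> l) \<and>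
          (\<forall>i<n. \<forall>j<n. i \<noteq> j \<longrightarrow> inf (x i) (x j) = y \<and> isLub UNIV {x i, x j} l)) \<and>
     (\<forall>z. z \<prec> l \<longrightarrow> (\<exists>i<n. z = x i))"

definition minimal_inconsistent_pair :: "'a::order \<Rightarrow> 'a \<Rightarrow> bool" where
  "minimal_inconsistent_pair x y \<longleftrightarrow>
     x \<in> Lir \<and> y \<in> Lir \<and> inconsistent x y \<and>
     (\<forall>x'\<in>Lir. \<forall>y'\<in>Lir. x' \<le> x \<longrightarrow> y' \<le> y \<longrightarrow> inconsistent x' y' \<longrightarrow> x' = x \<and> y' = y)"

text \<open>
  The closure of \<open>X\<close>, with \<open>None\<close> for undefined. Hence \<open>clos F X = clos F Y\<close> says exactly that the
  images of \<open>X\<close> and \<open>Y\<close> under the closure operator are equivalent.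
\<close>

definition clos :: "'e set set \<Rightarrow> 'e set \<Rightarrow> 'e set option" where
  "clos F X = (if \<exists>A\<in>F. X \<subseteq> A then Some (\<Inter>{A \<in> F. X \<subseteq> A}) else None)"

text \<open>In the first case every \<open>Y \<subseteq> X\<close> has a closure, because \<open>X\<close> has one.\<close>

definition quasiclosed :: "'e set \<Rightarrow> 'e set set \<Rightarrow> 'e set \<Rightarrow> bool" where
  "quasiclosed E F X \<longleftrightarrow> X \<subseteq> E \<and>
     (if clos F X \<noteq> None
      then \<forall>Y\<subseteq>X. clos F Y \<noteq> clos F X \<longrightarrow> the (clos F Y) \<subseteq> X
      else \<forall>Y\<subseteq>X. clos F Y \<noteq> None \<longrightarrow> the (clos F Y) \<subseteq> X)"

definition qclos :: "'e set \<Rightarrow> 'e set set \<Rightarrow> 'e set \<Rightarrow> 'e set" where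
  "qclos E F X = (LEAST Q. quasiclosed E F Q \<and> X \<subseteq> Q)"

definition properly_quasiclosed :: "'e set \<Rightarrow> 'e set set \<Rightarrow> 'e set \<Rightarrow> bool" where
  "properly_quasiclosed E F X \<longleftrightarrow> quasiclosed E F X \<and> X \<notin> F"

definition pseudoclosed :: "'e set \<Rightarrow> 'e set set \<Rightarrow> 'e set \<Rightarrow> bool" where
  "pseudoclosed E F P \<longleftrightarrow> properly_quasiclosed E F P \<and>
     (\<forall>Q. properly_quasiclosed E F Q \<longrightarrow> clos F Q = clos F P \<longrightarrow> Q \<subseteq> P \<longrightarrow> Q = P)"

end

theory Submission
  imports Defs
begin

text \<open>
  Finite consistent sets are handled through joins: \<open>\<C>(P(L))\<close> is the range of \<open>\<phi>\<close>, because an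
  irreducible below \<open>a \<squnion> b\<close> but below neither summand is collinear with irreducibles \<open>q \<le> a\<close> and
  \<open>r \<le> b\<close>. So a set of irreducibles has the closure \<open>\<phi> l\<close> of its join \<open>l\<close>, or none if it is
  unbounded.

  Let \<open>P\<close> be properly quasiclosed with join \<open>l\<close>. If \<open>l \<in> P\<close>, then \<open>{l}\<close> already is. Otherwise \<open>P\<close>
  contains \<open>q\<close> and \<open>r\<close> from a collinear triple \<open>q, r, p\<close> with join \<open>l\<close> and \<open>p \<notin> P\<close>. Every lower cover of
  \<open>l\<close> lies above the lower covers of \<open>q\<close> and \<open>r\<close>, hence above their join \<open>y\<close>. The interval from \<open>y\<close>
  to \<open>l\<close> has length two, which makes \<open>l\<close> an \<open>\<M>\<^sub>n\<close>-element, and \<open>P\<close> contains \<open>\<phi>\<close> of two lower covers.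

  If \<open>P\<close> is unbounded, it contains a minimal inconsistent pair \<open>(x, y)\<close>, hence \<open>\<phi> a \<union> \<phi> b\<close> for
  \<open>a = x \<squnion> lower_cover y\<close> and \<open>b = lower_cover x \<squnion> y\<close>. Both \<open>a\<close> and \<open>b\<close> cover
  \<open>lower_cover x \<squnion> lower_cover y\<close>, which makes \<open>\<phi> a \<union> \<phi> b\<close> quasiclosed, and every inconsistent pair
  inside it yields the same \<open>a\<close> and \<open>b\<close>.
\<close>

section \<open>Finite meet-semilattices\<close>

lemma isLub_UNIV_iff:
  "isLub UNIV X s \<longleftrightarrow> (\<forall>x\<in>X. x \<le> s) \<and> (\<forall>u. (\<forall>x\<in>X. x \<le> u) \<longrightarrow> s \<le> u)"
  by (auto simp: isLub_def leastP_def isUb_def setle_def setge_def Ball_def)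

lemma isLub_UNIV_unique:
  fixes s t :: "'a::order"
  shows "isLub UNIV X s \<Longrightarrow> isLub UNIV X t \<Longrightarrow> s = t"
  by (meson isLub_UNIV_iff order_antisym)

text \<open>The set of upper bounds is finite and contains \<open>u\<close>, so its meet exists, and
  this meet is the least upper bound. For empty \<open>X\<close> it is the minimum of the
  semilattice.\<close>

lemma ex_isLub:
  fixes u :: "'a::{finite, semilattice_inf}"
  assumes "\<forall>x\<in>X. x \<le> u"
  obtains s where "isLub UNIV X s"
proof
  let ?U = "{u. \<forall>x\<in>X. x \<le> u}"
  have U: "finite ?U" "?U \<noteq> {}" using assms by auto
  have "x \<le> Inf_fin ?U" if "x \<in> X" for x
    using that by (intro Inf_fin.boundedI[OF U]) auto
  then show "isLub UNIV X (Inf_fin ?U)"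
    unfolding isLub_UNIV_iff by (auto intro: Inf_fin.coboundedI[OF U(1)])
qed

lemma has_join_iff:
  fixes x y :: "'a::{finite, semilattice_inf}"
  shows "has_join x y \<longleftrightarrow> (\<exists>u. x \<le> u \<and> y \<le> u)"
proof
  assume "\<exists>u. x \<le> u \<and> y \<le> u"
  then obtain u where "\<forall>z\<in>{x, y}. z \<le> u" by auto
  then show "has_join x y" unfolding has_join_def by (rule ex_isLub) blast
qed (auto simp: has_join_def isLub_UNIV_iff)

lemma has_joinI:
  fixes x y :: "'a::{finite, semilattice_inf}"
  shows "x \<le> u \<Longrightarrow> y \<le> u \<Longrightarrow> has_join x y"
  by (auto simp: has_join_iff)

lemma has_join_commute: "has_join x y \<longleftrightarrow> has_join y x"
  by (simp add: has_join_def insert_commute)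

lemma has_join_mono:
  fixes x y :: "'a::{finite, semilattice_inf}"
  shows "has_join x y \<Longrightarrow> x' \<le> x \<Longrightarrow> y' \<le> y \<Longrightarrow> has_join x' y'"
  by (meson has_join_iff order_trans)

notation inf (infixl \<open>\<sqinter>\<close> 70)

text \<open>A total stand-in for the partial join; its value is unspecified when the join does not
  exist, hence the side conditions \<open>has_join\<close> below.\<close>

definition pjoin :: "'a::order \<Rightarrow> 'a \<Rightarrow> 'a" (infixl \<open>\<squnion>\<close> 65) where
  "x \<squnion> y = (THE s. isLub UNIV {x, y} s)"

lemma isLub_iff_pjoin:
  "isLub UNIV {x, y} s \<longleftrightarrow> has_join x y \<and> x \<squnion> y = s"
  unfolding pjoin_def has_join_def
  by (metis isLub_UNIV_unique the_equality)

lemma isLub_pjoin: "has_join x y \<Longrightarrow> isLub UNIV {x, y} (x \<squnion> y)"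
  by (simp add: isLub_iff_pjoin)

lemma pjoin_commute: "x \<squnion> y = y \<squnion> x"
  by (simp add: pjoin_def insert_commute)

lemma pjoin_ge1: "has_join x y \<Longrightarrow> x \<le> x \<squnion> y"
  and pjoin_ge2: "has_join x y \<Longrightarrow> y \<le> x \<squnion> y"
  by (auto dest!: isLub_pjoin simp: isLub_UNIV_iff)

lemma pjoin_le_iff: "has_join x y \<Longrightarrow> x \<squnion> y \<le> u \<longleftrightarrow> x \<le> u \<and> y \<le> u"
  using isLub_pjoin[of x y] by (force simp: isLub_UNIV_iff)

lemma pjoin_least:
  fixes x y :: "'a::{finite, semilattice_inf}"
  shows "x \<le> u \<Longrightarrow> y \<le> u \<Longrightarrow> x \<squnion> y \<le> u"
  using has_joinI pjoin_le_iff by blast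

lemma inf_less_iff: "x \<sqinter> y < x \<longleftrightarrow> \<not> x \<le> (y::'a::semilattice_inf)"
  unfolding order_less_le inf.absorb_iff1[of x y] by simp

lemma ex_is_minimum: "\<exists>m::'a::{finite, semilattice_inf}. is_minimum m"
  using ex_isLub[of "{}::'a set"] by (auto simp: isLub_UNIV_iff is_minimum_def)

lemma ex_maximal_ge:
  fixes a :: "'a::{finite, order}"
  assumes "P a"
  obtains m where "P m" "a \<le> m" "\<And>z. P z \<Longrightarrow> m \<le> z \<Longrightarrow> z = m"
  using finite_has_maximal2[of "Collect P" a] assms by (metis finite mem_Collect_eq)

text \<open>The size of the principal ideal serves as the rank for inductions and for choosing
  minimal pairs.\<close>

lemma card_down_less:
  fixes x y :: "'a::{finite, order}"
  shows "x < y \<Longrightarrow> card {..x} < card {..y}"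
  by (intro psubset_card_mono) (auto simp: psubset_eq set_eq_iff intro: order.trans dest: leD)

lemma card_down_le:
  fixes x y :: "'a::{finite, order}"
  shows "x \<le> y \<Longrightarrow> card {..x} \<le> card {..y}"
  by (rule card_mono) auto

section \<open>Covering relations\<close>

lemma covered_by_between: "a \<prec> b \<Longrightarrow> a \<le> z \<Longrightarrow> z \<le> b \<Longrightarrow> z = a \<or> z = b"
  unfolding covered_by_def by (metis order_le_less)

lemma covered_by_less: "a \<prec> b \<Longrightarrow> a < b"
  by (simp add: covered_by_def)

lemma covered_by_antichain: "u \<prec> l \<Longrightarrow> v \<prec> l \<Longrightarrow> u \<le> v \<Longrightarrow> u = v"
  unfolding covered_by_def by (metis order_le_less)

lemma covered_by_pjoin:
  fixes z l :: "'a::{finite, semilattice_inf}"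
  assumes "z \<prec> l" "x \<le> l" "\<not> x \<le> z"
  shows "x \<squnion> z = l"
proof -
  have "has_join x z" using assms by (meson covered_by_less has_joinI order_less_imp_le)
  then show ?thesis
    using covered_by_between[OF assms(1), of "x \<squnion> z"] assms pjoin_ge1[of x z] pjoin_ge2[of x z]
    by (metis covered_by_less order_less_imp_le pjoin_least)
qed

lemma ex_covered_by_ge:
  fixes a l :: "'a::{finite, order}"
  assumes "a < l"
  obtains z where "z \<prec> l" "a \<le> z"
proof -
  obtain z where "z < l" "a \<le> z" "\<And>w. w < l \<Longrightarrow> z \<le> w \<Longrightarrow> w = z"
    by (rule ex_maximal_ge[of "\<lambda>z. z < l", OF assms]) blast
  then show thesis using that unfolding covered_by_def by (metis order_less_le)
qed

section \<open>Join-irreducible elements and the map \<open>\<phi>\<close>\<close>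

lemma LirD: "p \<in> Lir \<Longrightarrow> has_join a b \<Longrightarrow> a \<squnion> b = p \<Longrightarrow> a = p \<or> b = p"
  unfolding Lir_def join_irreducible_def using isLub_iff_pjoin by fastforce

text \<open>A join of two elements strictly below \<open>p\<close> would lie below \<open>w\<close>,
  which \<open>p\<close> does not.\<close>

lemma LirI:
  fixes p :: "'a::{finite, semilattice_inf}"
  assumes "\<not> p \<le> w" "\<And>a. a < p \<Longrightarrow> a \<le> w"
  shows "p \<in> Lir"
proof -
  have "p = a \<or> p = b" if "isLub UNIV {a, b} p" for a b
    using that assms unfolding isLub_UNIV_iff by (metis insert_iff order_le_less singletonD)
  moreover have "\<not> is_minimum p" using assms(1) by (auto simp: is_minimum_def)
  ultimately show ?thesis unfolding Lir_def join_irreducible_def by blast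
qed

text \<open>A maximal element \<open>m\<close> strictly below \<open>q\<close> is already the
  greatest one: for \<open>x < q\<close> irreducibility keeps \<open>m \<squnion> x\<close> strictly
  below \<open>q\<close>, so maximality gives \<open>m \<squnion> x = m\<close>.\<close>

lemma
  fixes q :: "'a::{finite, semilattice_inf}"
  assumes "q \<in> Lir"
  shows lower_cover_covered: "lower_cover q \<prec> q"
    and less_imp_le_lower_cover: "x < q \<Longrightarrow> x \<le> lower_cover q"
proof -
  obtain z where "\<not> q \<le> z"
    using assms by (auto simp: Lir_def join_irreducible_def is_minimum_def)
  then have *: "q \<sqinter> z < q" by (simp add: inf_less_iff)
  obtain m where m: "m < q" "\<And>w. w < q \<Longrightarrow> m \<le> w \<Longrightarrow> w = m"
    by (rule ex_maximal_ge[of "\<lambda>w. w < q", OF *]) blast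
  have le: "x \<le> m" if "x < q" for x
  proof -
    have j: "has_join m x" using m(1) that by (meson has_joinI order_less_imp_le)
    have "m \<squnion> x \<noteq> q" using LirD[OF assms j] m(1) that by auto
    then have "m \<squnion> x < q"
      using m(1) that by (meson order_less_imp_le order_le_imp_less_or_eq pjoin_least)
    then show ?thesis using m(2) pjoin_ge1[OF j] pjoin_ge2[OF j] by metis
  qed
  have mq: "m \<prec> q" using le m(1) unfolding covered_by_def by (meson leD)
  have "lower_cover q = m"
    unfolding lower_cover_def
  proof (rule the_equality)
    show "m \<prec> q" by (rule mq)
    fix z assume "z \<prec> q"
    then show "z = m"
      using covered_by_between[of z q m] covered_by_less le m(1)
      by (metis order_less_imp_le order_less_irrefl)
  qed
  then show "lower_cover q \<prec> q" "x < q \<Longrightarrow> x \<le> lower_cover q"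
    using le mq by simp_all
qed

lemma lower_cover_le:
  fixes q :: "'a::{finite, semilattice_inf}"
  shows "q \<in> Lir \<Longrightarrow> lower_cover q \<le> q"
  by (meson covered_by_less lower_cover_covered order_less_imp_le)

text \<open>Induction on the size of the ideal of \<open>a\<close>: an element that is neither
  irreducible nor the minimum is the join of two strictly smaller ones.\<close>

lemma Lir_dense:
  fixes a :: "'a::{finite, semilattice_inf}"
  assumes "\<And>p. p \<in> \<phi> a \<Longrightarrow> p \<le> b"
  shows "a \<le> b"
  using assms
proof (induction "card {..a}" arbitrary: a rule: less_induct)
  case less
  show ?case
  proof (cases "join_irreducible a")
    case True
    then show ?thesis using less.prems by (auto simp: \<phi>_def Lir_def)
  next
    case False
    show ?thesis
    proof (cases "is_minimum a")
      case True
      then show ?thesis by (simp add: is_minimum_def)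
    next
      case nm: False
      then obtain x y where xy: "isLub UNIV {x, y} a" "a \<noteq> x" "a \<noteq> y"
        using False unfolding join_irreducible_def by auto
      then have l: "x < a" "y < a" by (auto simp: isLub_UNIV_iff order_less_le)
      have "z \<le> b" if "z < a" for z
        by (rule less.hyps) (use that less.prems card_down_less in \<open>auto simp: \<phi>_def intro: order.trans\<close>)
      then show ?thesis using l xy(1) by (auto simp: isLub_UNIV_iff)
    qed
  qed
qed

lemma phi_subset_iff:
  fixes a b :: "'a::{finite, semilattice_inf}"
  shows "\<phi> a \<subseteq> \<phi> b \<longleftrightarrow> a \<le> b"
proof
  assume "\<phi> a \<subseteq> \<phi> b"
  then show "a \<le> b" using Lir_dense[of a b] by (auto simp: \<phi>_def)
qed (auto simp: \<phi>_def)

lemma phi_eq_iff: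
  fixes a b :: "'a::{finite, semilattice_inf}"
  shows "\<phi> a = \<phi> b \<longleftrightarrow> a = b"
  by (metis order_antisym order_refl phi_subset_iff)

lemma isLub_phi: "isLub UNIV (\<phi> a) (a::'a::{finite, semilattice_inf})"
  unfolding isLub_UNIV_iff using Lir_dense by (auto simp: \<phi>_def)

lemma phi_subset_Lir: "\<phi> a \<subseteq> Lir"
  by (auto simp: \<phi>_def)

lemma isLub_phi_Un:
  fixes a b :: "'a::{finite, semilattice_inf}"
  assumes "has_join a b"
  shows "isLub UNIV (\<phi> a \<union> \<phi> b) (a \<squnion> b)"
proof -
  have "p \<le> a \<squnion> b" if "p \<in> \<phi> a \<union> \<phi> b" for p
    using that pjoin_ge1[OF assms] pjoin_ge2[OF assms] by (auto simp: \<phi>_def)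
  moreover have "a \<squnion> b \<le> u" if "\<forall>p\<in>\<phi> a \<union> \<phi> b. p \<le> u" for u
    using that Lir_dense[of a u] Lir_dense[of b u] by (intro pjoin_least) auto
  ultimately show ?thesis unfolding isLub_UNIV_iff by blast
qed

lemma minimal_inconsistent_pair_commute:
  "minimal_inconsistent_pair x y \<longleftrightarrow> minimal_inconsistent_pair y x"
  unfolding minimal_inconsistent_pair_def inconsistent_def
  using has_join_commute by blast

text \<open>Among the inconsistent pairs below \<open>(p, q)\<close>, take one with the least total
  ideal size; lowering either entry properly would decrease this size.\<close>

lemma ex_minimal_inconsistent_pair:
  fixes p q :: "'a::{finite, semilattice_inf}"
  assumes "p \<in> Lir" "q \<in> Lir" "\<not> has_join p q"
  obtains x y where "minimal_inconsistent_pair x y" "x \<le> p" "y \<le> q"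
proof -
  let ?P = "\<lambda>(x, y). x \<in> Lir \<and> y \<in> Lir \<and> x \<le> p \<and> y \<le> q \<and> \<not> has_join x y"
  let ?m = "\<lambda>(x::'a, y::'a). card {..x} + card {..y}"
  have "?P (p, q)" using assms by auto
  from ex_has_least_nat[of ?P, OF this, of ?m] obtain x y where xy: "?P (x, y)"
    and least: "\<And>x' y'. ?P (x', y') \<Longrightarrow> ?m (x, y) \<le> ?m (x', y')"
    by auto
  have "x' = x \<and> y' = y"
    if "x' \<in> Lir" "y' \<in> Lir" "x' \<le> x" "y' \<le> y" "\<not> has_join x' y'" for x' y'
  proof -
    have "?m (x, y) \<le> ?m (x', y')"
      by (rule least) (use that xy in \<open>auto intro: order.trans\<close>)
    then have "\<not> card {..x'} < card {..x}" "\<not> card {..y'} < card {..y}"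
      using card_down_le[OF that(3)] card_down_le[OF that(4)] by auto
    then show ?thesis using that card_down_less by (auto simp: order_le_less)
  qed
  then have "minimal_inconsistent_pair x y"
    using xy unfolding minimal_inconsistent_pair_def inconsistent_def by blast
  then show thesis using xy that by blast
qed

lemma phi_eq_empty_iff:
  fixes z :: "'a::{finite, semilattice_inf}"
  shows "\<phi> z = {} \<longleftrightarrow> is_minimum z"
proof
  assume "\<phi> z = {}"
  moreover obtain m :: 'a where m: "is_minimum m" using ex_is_minimum by blast
  ultimately have "z \<le> m" using phi_subset_iff[of z m] by simp
  then show "is_minimum z" using m unfolding is_minimum_def by (meson order_trans)
next
  assume "is_minimum z"
  then have "is_minimum p" if "p \<le> z" for p
    using that unfolding is_minimum_def by (meson order_trans)
  then show "\<phi> z = {}" unfolding \<phi>_def Lir_def join_irreducible_def by blast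
qed

text \<open>\<open>\<phi> q\<close> consists of \<open>q\<close> and the irreducibles below
  \<open>lower_cover q\<close>; there are none of the latter exactly when that cover is the
  minimum.\<close>

lemma nonatomic_iff:
  fixes q :: "'a::{finite, semilattice_inf}"
  assumes "q \<in> Lir"
  shows "nonatomic q \<longleftrightarrow> \<phi> q \<noteq> {q}"
proof -
  have "p \<le> q \<longleftrightarrow> p = q \<or> p \<le> lower_cover q" for p
  proof
    assume "p \<le> q"
    then show "p = q \<or> p \<le> lower_cover q"
      using less_imp_le_lower_cover[OF assms, of p] by (auto simp: order_le_less)
  next
    assume "p = q \<or> p \<le> lower_cover q"
    then show "p \<le> q" using lower_cover_le[OF assms] by (elim disjE) (simp, rule order_trans)
  qed
  then have "\<phi> q = insert q (\<phi> (lower_cover q))"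
    using assms by (auto simp: \<phi>_def)
  moreover have "q \<notin> \<phi> (lower_cover q)"
    using lower_cover_covered[OF assms] by (auto simp: \<phi>_def covered_by_def)
  ultimately have "\<phi> q = {q} \<longleftrightarrow> \<phi> (lower_cover q) = {}" by auto
  then show ?thesis unfolding nonatomic_def phi_eq_empty_iff by blast
qed

section \<open>Finite modular semilattices\<close>

locale finite_modular_semilattice =
  fixes L :: "'a::{finite, semilattice_inf} itself"
  assumes modular: "modular_semilattice L"
begin

text \<open>Modularity is given only inside principal ideals. Replacing \<open>z\<close> by
  \<open>w = t \<sqinter> z\<close> moves everything into the ideal of
  \<open>t = x \<squnion> y\<close> and changes neither side of the equation.\<close>

lemma modular_law:
  fixes x y z :: 'a
  assumes j: "has_join x y" and le: "x \<le> z"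
  shows "x \<squnion> (y \<sqinter> z) = (x \<squnion> y) \<sqinter> z"
proof -
  define t where "t = x \<squnion> y"
  have t: "x \<le> t" "y \<le> t" using j by (auto simp: t_def pjoin_ge1 pjoin_ge2)
  define w where "w = t \<sqinter> z"
  have w: "w \<le> t" "x \<le> w" using t le by (auto simp: w_def)
  \<comment> \<open>Joins and meets computed inside the ideal of \<open>t\<close> agree with the
    global ones.\<close>
  have lub: "isLub {..t} {a, b} (a \<squnion> b)" if "a \<le> t" "b \<le> t" for a b
    using isLub_pjoin[OF has_joinI[OF that]] pjoin_least[OF that] that
    by (auto simp: isLub_def leastP_def isUb_def setle_def setge_def)
  have glb: "isGlb {..t} {a, b} (a \<sqinter> b)" if "a \<le> t" "b \<le> t" for a b
    using that
    by (auto simp: isGlb_def greatestP_def isLb_def setle_def setge_def intro: le_infI1)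
  have yw: "y \<sqinter> w \<le> t" by (simp add: le_infI1 t)
  have "modular_lattice_on {..t}"
    using modular unfolding modular_semilattice_def by blast
  then have "l = r"
    if "isGlb {..t} {y, w} yz" "isLub {..t} {x, yz} l" "isLub {..t} {x, y} xy" "isGlb {..t} {xy, w} r"
    for yz xy l r
    using that t w unfolding modular_lattice_on_def by (meson atMost_iff)
  from this[OF glb[OF t(2) w(1)] lub[OF t(1) yw] lub[OF t] glb]
  have "x \<squnion> (y \<sqinter> w) = (x \<squnion> y) \<sqinter> w"
    using w(1) by (simp add: t_def)
  moreover have "y \<sqinter> w = y \<sqinter> z"
    using t by (metis inf.absorb1 inf.assoc w_def)
  ultimately show ?thesis by (simp add: w_def t_def)
qed

lemma has_join3:
  fixes x y z :: 'a
  assumes "has_join x y" "has_join y z" "has_join x z"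
  obtains s where "x \<le> s" "y \<le> s" "z \<le> s"
  using assms modular unfolding modular_semilattice_def isLub_UNIV_iff by blast

text \<open>Induction on \<open>T\<close>: the new element \<open>t\<close>, the join
  \<open>m'\<close> of the others and \<open>z\<close> are pairwise consistent, so
  \<open>has_join3\<close> bounds all three.\<close>

lemma has_join_isLub:
  fixes m z :: 'a
  assumes "isLub UNIV T m" "\<forall>t\<in>T. has_join t z"
  shows "has_join m z"
proof -
  have "finite T" by simp
  then show ?thesis using assms
  proof (induction T arbitrary: m rule: finite_induct)
    case empty
    then show ?case by (metis empty_iff has_joinI isLub_UNIV_iff order_refl)
  next
    case (insert t T)
    then have ub: "\<forall>x\<in>T. x \<le> m" "t \<le> m" by (auto simp: isLub_UNIV_iff)
    obtain m' where m': "isLub UNIV T m'" by (rule ex_isLub[OF ub(1)])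
    then have "m' \<le> m" using ub(1) by (simp add: isLub_UNIV_iff)
    then have "has_join t m'" using ub(2) by (rule has_joinI[rotated])
    moreover have "has_join m' z" "has_join t z" using insert m' by auto
    ultimately obtain s where s: "t \<le> s" "m' \<le> s" "z \<le> s" by (rule has_join3)
    then have "m \<le> s"
      using insert.prems(1) m' unfolding isLub_UNIV_iff by (metis insert_iff order_trans)
    then show ?case using s(3) by (rule has_joinI)
  qed
qed

lemma has_join_phi:
  fixes a z :: 'a
  shows "(\<And>p. p \<in> \<phi> a \<Longrightarrow> has_join p z) \<Longrightarrow> has_join a z"
  using has_join_isLub isLub_phi by blast

lemma pairwise_bounded:
  fixes T :: "'a set"
  assumes "\<forall>p\<in>T. \<forall>q\<in>T. has_join p q"
  shows "\<exists>u. \<forall>t\<in>T. t \<le> u"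
proof -
  have "finite T" by simp
  then show ?thesis using assms
  proof (induction T rule: finite_induct)
    case (insert t T)
    then obtain u where "\<forall>x\<in>T. x \<le> u" by auto
    then obtain s where s: "isLub UNIV T s" by (rule ex_isLub)
    then have "has_join s t" using insert.prems by (intro has_join_isLub) auto
    then obtain w where "s \<le> w" "t \<le> w" by (auto simp: has_join_iff)
    then show ?case using s unfolding isLub_UNIV_iff by (metis insert_iff order_trans)
  qed simp
qed

section \<open>Lower covers of irreducibles under the modular law\<close>

text \<open>By the modular law \<open>(lower_cover q \<squnion> r) \<sqinter> q\<close> equals
  \<open>lower_cover q \<squnion> (r \<sqinter> q)\<close>, and \<open>r \<sqinter> q\<close>, being
  strictly below \<open>q\<close>, adds nothing to \<open>lower_cover q\<close>.\<close>

lemma not_le_lower_cover_pjoin: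
  fixes q r :: 'a
  assumes "q \<in> Lir" "has_join q r" "\<not> q \<le> r"
  shows "\<not> q \<le> lower_cover q \<squnion> r"
proof
  assume le: "q \<le> lower_cover q \<squnion> r"
  have "r \<sqinter> q < q" using assms(3) by (simp add: inf_less_iff inf_commute)
  then have "r \<sqinter> q \<le> lower_cover q" using less_imp_le_lower_cover assms(1) by blast
  then have "lower_cover q \<squnion> (r \<sqinter> q) \<le> lower_cover q" by (simp add: pjoin_least)
  moreover have "lower_cover q \<squnion> (r \<sqinter> q) = (lower_cover q \<squnion> r) \<sqinter> q"
    using assms lower_cover_le by (blast intro: modular_law has_join_mono)
  ultimately have "q \<le> lower_cover q" using le by (simp add: inf.absorb2)
  then show False using lower_cover_covered[OF assms(1)] by (auto simp: covered_by_def)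
qed

text \<open>An element \<open>z\<close> strictly in between is above \<open>r\<close> but not above
  \<open>q\<close>, so \<open>q \<sqinter> z \<le> lower_cover q\<close>. The modular law gives
  \<open>z = r \<squnion> (q \<sqinter> z)\<close>, which forces \<open>z\<close> down to the lower
  end.\<close>

lemma covered_by_pjoin_lower_cover:
  fixes q r :: 'a
  assumes "q \<in> Lir" "has_join q r" "\<not> q \<le> r"
  shows "lower_cover q \<squnion> r \<prec> q \<squnion> r"
proof -
  have j: "has_join (lower_cover q) r"
    using assms lower_cover_le by (blast intro: has_join_mono)
  note ge = pjoin_ge1[OF assms(2)] pjoin_ge2[OF assms(2)]
  have "lower_cover q \<squnion> r \<le> q \<squnion> r"
    using ge lower_cover_le[OF assms(1)] by (meson order_trans pjoin_least)
  moreover have "\<not> q \<squnion> r \<le> lower_cover q \<squnion> r"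
    using not_le_lower_cover_pjoin[OF assms] ge(1) by (meson order_trans)
  moreover have "\<not> (lower_cover q \<squnion> r < z \<and> z < q \<squnion> r)" for z
  proof
    assume z: "lower_cover q \<squnion> r < z \<and> z < q \<squnion> r"
    then have rz: "r \<le> z" using pjoin_ge2[OF j] by (meson order_less_imp_le order_trans)
    then have "\<not> q \<le> z" using z by (metis leD pjoin_least)
    then have "q \<sqinter> z < q" by (simp add: inf_less_iff)
    then have "q \<sqinter> z \<le> lower_cover q" using less_imp_le_lower_cover assms(1) by blast
    then have "r \<squnion> (q \<sqinter> z) \<le> lower_cover q \<squnion> r"
      using pjoin_ge1[OF j] pjoin_ge2[OF j] by (meson order_trans pjoin_least)
    moreover have "r \<squnion> (q \<sqinter> z) = (r \<squnion> q) \<sqinter> z"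
      using assms rz has_join_commute by (blast intro: modular_law)
    ultimately show False using z
      by (metis inf.absorb2 leD order_less_imp_le pjoin_commute)
  qed
  ultimately show ?thesis by (auto simp: covered_by_def order_less_le)
qed

text \<open>Otherwise \<open>lower_cover q \<squnion> z\<close> would be \<open>l\<close> and hence
  lie above \<open>q\<close>, against \<open>not_le_lower_cover_pjoin\<close>.\<close>

lemma lower_cover_le_covered:
  fixes q z l :: 'a
  assumes "q \<in> Lir" "q \<le> l" "z \<prec> l"
  shows "lower_cover q \<le> z"
proof (rule ccontr)
  assume n: "\<not> lower_cover q \<le> z"
  then have nq: "\<not> q \<le> z" using lower_cover_le[OF assms(1)] by (meson order_trans)
  have "lower_cover q \<squnion> z = l"
    using assms n lower_cover_le[OF assms(1)] by (meson covered_by_pjoin order_trans)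
  moreover have "has_join q z" using assms by (meson covered_by_less has_joinI order_less_imp_le)
  ultimately show False using not_le_lower_cover_pjoin[OF assms(1) _ nq] assms(2) by auto
qed

section \<open>Collinear triples and the family as the range of \<open>\<phi>\<close>\<close>

text \<open>All elements strictly below a minimal \<open>a\<close> with \<open>p \<le> a \<squnion> b\<close> lie below
  \<open>lower_cover p \<squnion> b\<close>, whereas \<open>a\<close> does not; hence \<open>a\<close> is irreducible.\<close>

lemma minimal_summand:
  fixes a b p :: 'a
  assumes p: "p \<in> Lir" "p \<le> a \<squnion> b" "\<not> p \<le> b" and j: "has_join a b"
    and min: "\<And>a'. a' < a \<Longrightarrow> \<not> p \<le> a' \<squnion> b"
  shows "a \<in> Lir" "a \<le> p \<squnion> b"
proof -
  have jp: "has_join p b" using p(2) j by (meson has_joinI pjoin_ge2)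
  have jl: "has_join (lower_cover p) b" using jp lower_cover_le[OF p(1)] by (meson has_join_mono order_refl)
  \<comment> \<open>The part of \<open>a\<close> below \<open>p \<squnion> b\<close> still suffices
    as a summand, so by minimality it is all of \<open>a\<close>.\<close>
  have "b \<squnion> (a \<sqinter> (p \<squnion> b)) = (b \<squnion> a) \<sqinter> (p \<squnion> b)"
    using j jp by (intro modular_law) (auto simp: has_join_commute pjoin_ge2)
  then have "p \<le> a \<sqinter> (p \<squnion> b) \<squnion> b"
    using p(2) pjoin_ge1[OF jp] by (simp add: pjoin_commute)
  then show a: "a \<le> p \<squnion> b"
    using min[of "a \<sqinter> (p \<squnion> b)"] by (auto simp: inf_less_iff)
  show "a \<in> Lir"
  proof (rule LirI)
    show "\<not> a \<le> lower_cover p \<squnion> b"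
    proof
      assume "a \<le> lower_cover p \<squnion> b"
      then have "p \<le> lower_cover p \<squnion> b"
        using p(2) pjoin_ge2[OF jl] by (meson order_trans pjoin_least)
      then show False using not_le_lower_cover_pjoin p jp by blast
    qed
    fix a' assume a': "a' < a"
    then have j': "has_join a' b" using j by (meson has_join_mono order_less_imp_le order_refl)
    \<comment> \<open>The aim is that \<open>(b \<squnion> p) \<sqinter> (a' \<squnion> b)\<close>,
      which lies above \<open>a'\<close>, stays below
      \<open>lower_cover p \<squnion> b\<close>.\<close>
    have "\<not> p \<le> a' \<squnion> b" using min a' by blast
    then have "p \<sqinter> (a' \<squnion> b) < p" by (simp add: inf_less_iff)
    then have "p \<sqinter> (a' \<squnion> b) \<le> lower_cover p" using less_imp_le_lower_cover p(1) by blast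
    then have "b \<squnion> (p \<sqinter> (a' \<squnion> b)) \<le> lower_cover p \<squnion> b"
      using pjoin_ge1[OF jl] pjoin_ge2[OF jl] by (meson order_trans pjoin_least)
    moreover have "b \<squnion> (p \<sqinter> (a' \<squnion> b)) = (b \<squnion> p) \<sqinter> (a' \<squnion> b)"
      using jp j' by (intro modular_law) (auto simp: has_join_commute pjoin_ge2)
    moreover have "a' \<le> b \<squnion> p"
      using a a' by (metis order_less_imp_le order_trans pjoin_commute)
    moreover have "a' \<le> a' \<squnion> b" by (rule pjoin_ge1[OF j'])
    ultimately show "a' \<le> lower_cover p \<squnion> b" by (metis inf.bounded_iff order_trans)
  qed
qed

text \<open>Shrink \<open>(a, b)\<close> to a pair \<open>(q, r)\<close> of least total ideal size
  with \<open>p \<le> q \<squnion> r\<close>. By \<open>minimal_summand\<close> both entries are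
  irreducible, and each lies below the join of \<open>p\<close> with the other, so the three
  pairwise joins coincide.\<close>

lemma ex_collinear:
  fixes a b p :: 'a
  assumes p: "p \<in> Lir" "p \<le> a \<squnion> b" "\<not> p \<le> a" "\<not> p \<le> b" and j: "has_join a b"
  obtains q r where "q \<in> Lir" "r \<in> Lir" "q \<le> a" "r \<le> b" "collinear q r p"
proof -
  let ?P = "\<lambda>(q, r). q \<le> a \<and> r \<le> b \<and> p \<le> q \<squnion> r"
  let ?m = "\<lambda>(q::'a, r::'a). card {..q} + card {..r}"
  have "?P (a, b)" using p by auto
  from ex_has_least_nat[of ?P, OF this, of ?m] obtain q r where qr: "q \<le> a" "r \<le> b" "p \<le> q \<squnion> r"
    and least: "\<And>q' r'. ?P (q', r') \<Longrightarrow> ?m (q, r) \<le> ?m (q', r')"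
    by auto
  have min1: "\<not> p \<le> q' \<squnion> r" if "q' < q" for q'
    using least[of q' r] that qr card_down_less[OF that] by (auto simp: order_less_imp_le order.trans)
  have min2: "\<not> p \<le> r' \<squnion> q" if "r' < r" for r'
    using least[of q r'] that qr card_down_less[OF that]
    by (auto simp: order_less_imp_le order.trans pjoin_commute)
  have jqr: "has_join q r" using j qr(1,2) by (rule has_join_mono)
  then have jrq: "has_join r q" by (simp add: has_join_commute)
  have np: "\<not> p \<le> q" "\<not> p \<le> r" using p qr by (meson order_trans)+
  have q: "q \<in> Lir" "q \<le> p \<squnion> r"
    using minimal_summand[OF p(1) qr(3) np(2) jqr] min1 by auto
  have r: "r \<in> Lir" "r \<le> p \<squnion> q"
    using minimal_summand[OF p(1) _ np(1) jrq] min2 qr(3) by (auto simp: pjoin_commute)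
  have jp: "has_join p q" "has_join p r"
    using qr(3) pjoin_ge1[OF jqr] pjoin_ge2[OF jqr] by (meson has_joinI)+
  have e1: "p \<squnion> q = q \<squnion> r"
    using qr(3) r(2) jp jqr by (intro order_antisym) (auto simp: pjoin_le_iff pjoin_ge1 pjoin_ge2)
  have e2: "p \<squnion> r = q \<squnion> r"
    using qr(3) q(2) jp jqr by (intro order_antisym) (auto simp: pjoin_le_iff pjoin_ge1 pjoin_ge2)
  have "\<not> q \<le> r" "\<not> r \<le> q"
    using qr(3) np by (meson order_refl order_trans pjoin_least)+
  \<comment> \<open>If one of \<open>q\<close> and \<open>r\<close> were below \<open>p\<close>, so
    would be the other, and \<open>p\<close> would be the join of two elements different from
    it.\<close>
  moreover have "\<not> (q \<le> p \<and> r \<le> p)"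
    using LirD[OF p(1) jqr] qr(3) np by (metis order_antisym order_refl pjoin_least)
  then have "\<not> q \<le> p" "\<not> r \<le> p"
    using q(2) r(2) by (meson order_refl order_trans pjoin_least)+
  ultimately have "collinear q r p"
    unfolding collinear_def incomparable_def isLub_iff_pjoin
    using np jp jqr e1 e2 by (auto simp: pjoin_commute has_join_commute)
  then show thesis using that q r qr by blast
qed

text \<open>The substantial inclusion rests on closure under joins: consistency in \<open>X\<close>
  makes the joins exist, and \<open>ex_collinear\<close> puts the irreducibles below them into
  \<open>X\<close>.\<close>

lemma consistent_subspaces_eq: "consistent_subspaces = range (\<phi> :: 'a \<Rightarrow> 'a set)"
proof (intro set_eqI iffI)
  fix X :: "'a set"
  assume "X \<in> range \<phi>"
  then obtain l where X: "X = \<phi> l" by auto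
  show "X \<in> consistent_subspaces"
    unfolding consistent_subspaces_def
  proof (intro CollectI conjI ballI impI)
    show "X \<subseteq> Lir" unfolding X by (rule phi_subset_Lir)
  next
    fix p q assume "p \<in> X" "q \<in> Lir" "q \<le> p"
    then show "q \<in> X" by (auto simp: X \<phi>_def)
  next
    fix p q assume "p \<in> X" "q \<in> X"
    then show "\<not> inconsistent p q"
      using has_joinI[of p l q] by (simp add: X \<phi>_def inconsistent_def)
  next
    fix p q r assume h: "p \<in> X" "q \<in> X" "r \<in> Lir" "collinear p q r"
    obtain s where "isLub UNIV {p, q} s" "isLub UNIV {q, r} s"
      using h(4) unfolding collinear_def by blast
    then have "r \<le> l" using h(1,2) by (auto simp: X \<phi>_def isLub_UNIV_iff)
    then show "r \<in> X" using h(3) by (simp add: X \<phi>_def)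
  qed
next
  fix X :: "'a set"
  assume X: "X \<in> consistent_subspaces"
  note X' = X[unfolded consistent_subspaces_def mem_Collect_eq inconsistent_def not_not]
  note XL = X'[THEN conjunct1]
    and down = X'[THEN conjunct2, THEN conjunct1, rule_format]
    and cons = X'[THEN conjunct2, THEN conjunct2, THEN conjunct1, rule_format]
    and col = X'[THEN conjunct2, THEN conjunct2, THEN conjunct2, rule_format]
  have join: "has_join a b \<and> \<phi> (a \<squnion> b) \<subseteq> X" if "\<phi> a \<subseteq> X" "\<phi> b \<subseteq> X" for a b
  proof
    have "has_join p b" if "p \<in> \<phi> a" for p
      using that \<open>\<phi> a \<subseteq> X\<close> \<open>\<phi> b \<subseteq> X\<close> cons has_join_commute
      by (metis has_join_phi subsetD)
    then show j: "has_join a b" by (rule has_join_phi)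
    show "\<phi> (a \<squnion> b) \<subseteq> X"
    proof
      fix p assume "p \<in> \<phi> (a \<squnion> b)"
      then have p: "p \<in> Lir" "p \<le> a \<squnion> b" by (auto simp: \<phi>_def)
      show "p \<in> X"
      proof (cases "p \<le> a \<or> p \<le> b")
        case True
        then show ?thesis using p that by (auto simp: \<phi>_def)
      next
        case False
        then obtain q r where "q \<in> Lir" "r \<in> Lir" "q \<le> a" "r \<le> b" "collinear q r p"
          using ex_collinear[OF p _ _ j] by metis
        moreover from this have "q \<in> X" "r \<in> X" using that by (auto simp: \<phi>_def)
        ultimately show ?thesis using col p(1) by blast
      qed
    qed
  qed
  \<comment> \<open>Elements are adjoined one at a time; the finite set \<open>T = X\<close> then
    gives \<open>X = \<phi> l\<close>.\<close>
  have "\<exists>l. \<phi> l \<subseteq> X \<and> T \<subseteq> \<phi> l" if "finite T" "T \<subseteq> X" for T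
    using that
  proof (induction T rule: finite_induct)
    case empty
    obtain m :: 'a where "is_minimum m" using ex_is_minimum by blast
    then have "\<phi> m = {}" by (simp add: phi_eq_empty_iff)
    then show ?case by auto
  next
    case (insert t T)
    then obtain l where l: "\<phi> l \<subseteq> X" "T \<subseteq> \<phi> l" by auto
    have t: "t \<in> X" "t \<in> Lir" using insert.prems XL by auto
    then have "\<phi> t \<subseteq> X" using down by (auto simp: \<phi>_def)
    then have j: "has_join l t" "\<phi> (l \<squnion> t) \<subseteq> X" using join l(1) by auto
    have "insert t T \<subseteq> \<phi> (l \<squnion> t)"
      using l(2) t(2) pjoin_ge1[OF j(1)] pjoin_ge2[OF j(1)] by (auto simp: \<phi>_def intro: order.trans)
    then show ?case using j(2) by blast
  qed
  then show "X \<in> range \<phi>" by (metis finite order_refl rangeI subset_antisym)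
qed

section \<open>From collinear triples to \<open>M_element\<close>\<close>

text \<open>The chain \<open>y \<prec> u \<prec> l\<close> shows that the interval above
  \<open>y\<close> has length two; modularity carries this over to every lower cover of
  \<open>l\<close>. The triple itself supplies three distinct lower covers \<open>u\<close>,
  \<open>v\<close>, \<open>w\<close>.\<close>

lemma M_element_if_collinear:
  fixes p q r :: 'a
  assumes irr: "p \<in> Lir" "q \<in> Lir" "r \<in> Lir" and col: "collinear q r p"
  shows "\<exists>n x. M_element n (q \<squnion> r) x"
proof -
  define l where "l = q \<squnion> r"
  define y where "y = lower_cover q \<squnion> lower_cover r"
  define u where "u = lower_cover q \<squnion> r"
  define v where "v = lower_cover r \<squnion> q"
  define w where "w = lower_cover q \<squnion> p"
  have inc: "\<not> q \<le> r" "\<not> r \<le> q" "\<not> q \<le> p"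
    using col by (auto simp: collinear_def incomparable_def)
  have j: "has_join q r" "has_join r p" "has_join q p" and e: "r \<squnion> p = l" "q \<squnion> p = l"
    using col by (auto simp: collinear_def isLub_iff_pjoin l_def)
  note jl = has_join_mono[OF j(1) lower_cover_le[OF irr(2)] order_refl]
    has_join_mono[OF j(1) order_refl lower_cover_le[OF irr(3)]]
    has_join_mono[OF j(3) lower_cover_le[OF irr(2)] order_refl]
  have le: "q \<le> l" "r \<le> l"
    unfolding l_def by (rule pjoin_ge1[OF j(1)], rule pjoin_ge2[OF j(1)])
  have u: "u \<prec> l" unfolding u_def l_def
    by (rule covered_by_pjoin_lower_cover[OF irr(2) j(1) inc(1)])
  have v: "v \<prec> l" unfolding v_def l_def pjoin_commute[of q r]
    by (rule covered_by_pjoin_lower_cover[OF irr(3) _ inc(2)]) (simp add: j has_join_commute)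
  have w: "w \<prec> l" unfolding w_def e(2)[symmetric]
    by (rule covered_by_pjoin_lower_cover[OF irr(2) j(3) inc(3)])
  have "\<not> r \<le> lower_cover q" using inc lower_cover_le[OF irr(2)] order_trans by blast
  then have yu: "y \<prec> u"
    using covered_by_pjoin_lower_cover[OF irr(3), of "lower_cover q"] jl(1)
    by (simp add: y_def u_def pjoin_commute has_join_commute)
  have "\<not> q \<le> lower_cover r" using inc lower_cover_le[OF irr(3)] order_trans by blast
  then have yv: "y \<prec> v"
    using covered_by_pjoin_lower_cover[OF irr(2), of "lower_cover r"] jl(2)
    by (simp add: y_def v_def pjoin_commute)
  \<comment> \<open>Any two of \<open>q\<close>, \<open>r\<close>, \<open>p\<close> join to
    \<open>l\<close>, so a lower cover of \<open>l\<close> is above at most one of them; this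
    separates \<open>u\<close>, \<open>v\<close> and \<open>w\<close>.\<close>
  have qrp: "\<not> (q \<le> z \<and> r \<le> z)" "\<not> (r \<le> z \<and> p \<le> z)" "\<not> (q \<le> z \<and> p \<le> z)" if "z \<prec> l" for z
    using covered_by_less[OF that] pjoin_least[of q z r] pjoin_least[of r z p] pjoin_least[of q z p] e
    by (auto simp: l_def dest: leD)
  have mem: "r \<le> u" "q \<le> v" "p \<le> w"
    unfolding u_def v_def w_def using jl by (simp_all add: pjoin_ge2 has_join_commute)
  have dist: "u \<noteq> v" "u \<noteq> w" "v \<noteq> w"
    using mem qrp(1)[OF u] qrp(2)[OF u] qrp(3)[OF v] by auto
  have y_le: "y \<le> z" if "z \<prec> l" for z
    unfolding y_def using that lower_cover_le_covered irr le by (intro pjoin_least) blast+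
  have lub: "isLub UNIV {z, z'} l" if "z \<prec> l" "z' \<prec> l" "z \<noteq> z'" for z z'
  proof -
    have zl: "z \<le> l" "z' \<le> l" using that covered_by_less order_less_imp_le by blast+
    have "\<not> z \<le> z'" using that covered_by_antichain by blast
    then show ?thesis
      using covered_by_pjoin[OF that(2) zl(1)] has_joinI[OF zl] by (simp add: isLub_iff_pjoin)
  qed
  have inf_u: "u \<sqinter> z = y" if z: "z \<prec> l" "z \<noteq> u" for z
  proof -
    have "\<not> u \<le> z" using covered_by_antichain[OF u z(1)] z(2) by auto
    then show ?thesis
      using covered_by_between[OF yu, of "u \<sqinter> z"] y_le[OF u] y_le[OF z(1)] inf_less_iff[of u z]
      by auto
  qed
  have yz: "y \<prec> z" if z: "z \<prec> l" for z
  proof (cases "z = u")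
    case False
    have zu: "u \<sqinter> z = y" using inf_u[OF z False] .
    \<comment> \<open>Such an \<open>s\<close> is not below \<open>u\<close>, since
      \<open>u \<sqinter> z = y\<close>; hence \<open>s \<squnion> u = l\<close>, and the modular
      law turns \<open>s \<squnion> y\<close> into \<open>z\<close>.\<close>
    have "s = z" if s: "y < s" "s \<le> z" for s
    proof -
      have sl: "s \<le> l" using s(2) covered_by_less[OF z] by auto
      have "\<not> s \<le> u" using s zu by (metis inf.bounded_iff leD)
      then have su: "s \<squnion> u = l" by (rule covered_by_pjoin[OF u sl])
      have "s \<squnion> (u \<sqinter> z) = (s \<squnion> u) \<sqinter> z"
        using has_joinI[OF sl order_less_imp_le[OF covered_by_less[OF u]]] s(2) by (rule modular_law)
      moreover have "s \<squnion> y \<le> s" using s(1) by (intro pjoin_least) auto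
      moreover have "l \<sqinter> z = z" using covered_by_less[OF z] by (simp add: inf.absorb2)
      ultimately show ?thesis using zu su s(2) by auto
    qed
    moreover have "y \<noteq> z"
      using covered_by_less[OF u] covered_by_less[OF yu] z unfolding covered_by_def by blast
    ultimately show ?thesis using y_le[OF z] unfolding covered_by_def by (auto simp: order_le_less)
  qed (simp add: yu)
  have inf_eq: "z \<sqinter> z' = y" if z: "z \<prec> l" "z' \<prec> l" "z \<noteq> z'" for z z'
  proof -
    have "\<not> z \<le> z'" using covered_by_antichain z by blast
    then show ?thesis
      using covered_by_between[OF yz[OF z(1)], of "z \<sqinter> z'"] y_le z inf_less_iff[of z z'] by auto
  qed
  \<comment> \<open>All lower covers of \<open>l\<close> are enumerated, not only \<open>u\<close>,
    \<open>v\<close>, \<open>w\<close>, as the last conjunct of \<open>M_element\<close>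
    demands.\<close>
  let ?C = "{z. z \<prec> l}"
  obtain x where x: "bij_betw x {0..<card ?C} ?C" using ex_bij_betw_nat_finite[of ?C] by auto
  have "card {u, v, w} \<le> card ?C" by (rule card_mono) (use u v w in auto)
  then have "3 \<le> card ?C" using dist by simp
  moreover have xl: "x i \<prec> l" if "i < card ?C" for i
    using bij_betwE[OF x] that by auto
  moreover have "x i \<noteq> x i'" if "i < card ?C" "i' < card ?C" "i \<noteq> i'" for i i'
    using bij_betw_imp_inj_on[OF x] that by (auto simp: inj_on_def)
  moreover have "\<exists>i<card ?C. z = x i" if "z \<prec> l" for z
    using bij_betw_imp_surj_on[OF x] that by (force simp: image_iff)
  ultimately have "M_element (card ?C) l x"
    unfolding M_element_def using yz inf_eq lub by (intro conjI exI[of _ y]) simp_all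
  then show ?thesis unfolding l_def by blast
qed

section \<open>Quasiclosed sets\<close>

lemma subset_phi_iff:
  fixes X :: "'a set"
  assumes "X \<subseteq> Lir" "isLub UNIV X l"
  shows "X \<subseteq> \<phi> a \<longleftrightarrow> l \<le> a"
proof -
  have "X \<subseteq> \<phi> a \<longleftrightarrow> (\<forall>x\<in>X. x \<le> a)" using assms(1) by (auto simp: \<phi>_def)
  also have "\<dots> \<longleftrightarrow> l \<le> a" using assms(2) unfolding isLub_UNIV_iff by (meson order_trans)
  finally show ?thesis .
qed

lemma clos_isLub:
  fixes X :: "'a set"
  assumes "X \<subseteq> Lir" "isLub UNIV X l"
  shows "clos (range \<phi>) X = Some (\<phi> l)"
proof -
  have "\<Inter>{A \<in> range \<phi>. X \<subseteq> A} = \<phi> l"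
  proof (intro order_antisym Inter_lower Inter_greatest)
    fix A assume "A \<in> {A \<in> range \<phi>. X \<subseteq> A}"
    then obtain a where "A = \<phi> a" "X \<subseteq> \<phi> a" by auto
    then show "\<phi> l \<subseteq> A" using subset_phi_iff[OF assms] by (simp add: phi_subset_iff)
  qed (use subset_phi_iff[OF assms] in auto)
  then show ?thesis unfolding clos_def using subset_phi_iff[OF assms, of l] by auto
qed

lemma clos_eq_None_iff:
  fixes X :: "'a set"
  assumes "X \<subseteq> Lir"
  shows "clos (range \<phi>) X = None \<longleftrightarrow> \<not> (\<exists>u. \<forall>x\<in>X. x \<le> u)"
  using assms by (auto simp: clos_def \<phi>_def subset_iff)

text \<open>Both cases of the definition merge: subsets with a closure are those with a join
  \<open>m\<close>, and the closure differs from that of \<open>X\<close> iff \<open>m\<close> is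
  not the join of \<open>X\<close>. For unbounded \<open>X\<close> this exclusion is
  vacuous.\<close>

lemma quasiclosed_iff:
  fixes X :: "'a set"
  assumes X: "X \<subseteq> Lir"
  shows "quasiclosed Lir (range \<phi>) X \<longleftrightarrow>
    (\<forall>Y m. Y \<subseteq> X \<longrightarrow> isLub UNIV Y m \<longrightarrow> \<not> isLub UNIV X m \<longrightarrow> \<phi> m \<subseteq> X)"
proof -
  have clos: "clos (range \<phi>) Y = Some (\<phi> m)" if "Y \<subseteq> X" "isLub UNIV Y m" for Y m
    using that X by (intro clos_isLub) auto
  have ex: "\<exists>m. isLub UNIV Y m" if "Y \<subseteq> X" "clos (range \<phi>) Y \<noteq> None" for Y
    using clos_eq_None_iff[of Y] that X ex_isLub[of Y] by (metis subset_trans)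
  show ?thesis
  proof (cases "clos (range \<phi>) X = None")
    case True
    then have "\<not> isLub UNIV X m" for m using clos[OF order_refl] by fastforce
    then have "quasiclosed Lir (range \<phi>) X \<longleftrightarrow>
      (\<forall>Y m. Y \<subseteq> X \<longrightarrow> isLub UNIV Y m \<longrightarrow> \<phi> m \<subseteq> X)"
      unfolding quasiclosed_def using X True clos ex
      by simp (metis option.distinct(1) option.sel)
    then show ?thesis using \<open>\<And>m. \<not> isLub UNIV X m\<close> by blast
  next
    case False
    then obtain l where l: "isLub UNIV X l" using ex by blast
    then have lub: "isLub UNIV X m \<longleftrightarrow> m = l" for m using isLub_UNIV_unique by blast
    have bd: "clos (range \<phi>) Y \<noteq> None" if "Y \<subseteq> X" for Y
      using that l X clos_eq_None_iff[of Y] unfolding isLub_UNIV_iff by blast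
    have "quasiclosed Lir (range \<phi>) X \<longleftrightarrow>
      (\<forall>Y m. Y \<subseteq> X \<longrightarrow> isLub UNIV Y m \<longrightarrow> \<phi> m \<noteq> \<phi> l \<longrightarrow> \<phi> m \<subseteq> X)"
      unfolding quasiclosed_def using X False clos ex bd clos[OF order_refl l]
      by simp (metis option.sel)
    then show ?thesis unfolding lub phi_eq_iff .
  qed
qed

lemma quasiclosedD:
  fixes X :: "'a set"
  assumes "quasiclosed Lir (range \<phi>) X" "Y \<subseteq> X" "isLub UNIV Y m" "\<not> isLub UNIV X m"
  shows "\<phi> m \<subseteq> X"
proof -
  have "X \<subseteq> Lir" using assms(1) by (simp add: quasiclosed_def)
  then show ?thesis using assms quasiclosed_iff by blast
qed

lemma quasiclosed_down:
  fixes X :: "'a set"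
  assumes "quasiclosed Lir (range \<phi>) X" "p \<in> X" "\<not> isLub UNIV X p"
  shows "\<phi> p \<subseteq> X"
  by (rule quasiclosedD[OF assms(1), of "{p}"]) (use assms in \<open>auto simp: isLub_UNIV_iff\<close>)

lemma quasiclosed_pjoin:
  fixes X :: "'a set"
  assumes "quasiclosed Lir (range \<phi>) X" "\<phi> a \<subseteq> X" "\<phi> b \<subseteq> X" "has_join a b"
    and "\<not> isLub UNIV X (a \<squnion> b)"
  shows "\<phi> (a \<squnion> b) \<subseteq> X"
  by (rule quasiclosedD[OF assms(1), of "\<phi> a \<union> \<phi> b"])
    (use assms in \<open>auto intro: isLub_phi_Un\<close>)

section \<open>Quasiclosed sets with a join\<close>

text \<open>A subset of \<open>R\<close> with join \<open>m < l\<close> lies below some lower cover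
  \<open>x k\<close>. If \<open>k\<close> is neither \<open>i\<close> nor \<open>j\<close>, its
  elements are also below \<open>x i\<close> or \<open>x j\<close>, hence below \<open>y\<close>; in
  either case \<open>\<phi> m\<close> stays in \<open>R\<close>.\<close>

lemma M_element_quasiclosed:
  fixes l :: 'a
  assumes M: "M_element n l x" and ij: "i < n" "j < n" "i \<noteq> j"
  defines "R \<equiv> \<phi> (x i) \<union> \<phi> (x j)"
  shows "R \<subseteq> Lir" "isLub UNIV R l" "properly_quasiclosed Lir (range \<phi>) R" "l \<notin> R"
    and "k < n \<Longrightarrow> \<phi> (x k) \<subseteq> R \<Longrightarrow> k = i \<or> k = j"
proof -
  obtain y where n: "3 \<le> n"
    and cov: "\<And>i. i < n \<Longrightarrow> y \<prec> x i" "\<And>i. i < n \<Longrightarrow> x i \<prec> l"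
    and inf: "\<And>i j. i < n \<Longrightarrow> j < n \<Longrightarrow> i \<noteq> j \<Longrightarrow> x i \<sqinter> x j = y"
    and lub: "\<And>i j. i < n \<Longrightarrow> j < n \<Longrightarrow> i \<noteq> j \<Longrightarrow> isLub UNIV {x i, x j} l"
    and all: "\<And>z. z \<prec> l \<Longrightarrow> \<exists>i<n. z = x i"
    using M unfolding M_element_def by blast
  show RL: "R \<subseteq> Lir" by (simp add: R_def phi_subset_Lir)
  have "has_join (x i) (x j)" "x i \<squnion> x j = l"
    using lub[OF ij] by (auto simp: isLub_iff_pjoin)
  then show R: "isLub UNIV R l" unfolding R_def using isLub_phi_Un by blast
  have lt: "x i < l" "x j < l" using cov(2) ij covered_by_less by blast+
  then show lR: "l \<notin> R" by (auto simp: R_def \<phi>_def)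
  have in_y: "p \<in> \<phi> y" if p: "p \<in> R" "p \<le> x k" and k: "k < n" "k \<noteq> i" "k \<noteq> j" for p k
  proof -
    have "p \<le> x k \<sqinter> x i \<or> p \<le> x k \<sqinter> x j" using p by (auto simp: R_def \<phi>_def)
    moreover have "x k \<sqinter> x i = y" "x k \<sqinter> x j = y" using inf k ij by auto
    ultimately show ?thesis using p RL by (auto simp: \<phi>_def)
  qed
  show cases: "k = i \<or> k = j" if "k < n" "\<phi> (x k) \<subseteq> R" for k
  proof (rule ccontr)
    assume "\<not> ?thesis"
    then have "\<phi> (x k) \<subseteq> \<phi> y" using in_y that by (auto simp: \<phi>_def)
    then have "x k \<le> y" by (simp add: phi_subset_iff)
    then show False using covered_by_less[OF cov(1)[OF that(1)]] by simp
  qed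
  have y: "\<phi> y \<subseteq> \<phi> (x i)" unfolding phi_subset_iff
    by (rule order_less_imp_le) (rule covered_by_less[OF cov(1)[OF ij(1)]])
  have "\<phi> m \<subseteq> R" if Y: "Y \<subseteq> R" "isLub UNIV Y m" "\<not> isLub UNIV R m" for Y m
  proof -
    have YL: "Y \<subseteq> Lir" using Y(1) RL by blast
    have "Y \<subseteq> \<phi> l" using Y(1) R YL unfolding isLub_UNIV_iff by (auto simp: \<phi>_def)
    then have "m \<le> l" using subset_phi_iff[OF YL Y(2)] by simp
    then have "m < l" using Y(3) R by (auto simp: order_le_less)
    then obtain z where z: "z \<prec> l" "m \<le> z" by (rule ex_covered_by_ge)
    then obtain k where k: "k < n" "z = x k" using all by blast
    show ?thesis
    proof (cases "k = i \<or> k = j")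
      case True
      then have "\<phi> m \<subseteq> \<phi> (x i) \<or> \<phi> m \<subseteq> \<phi> (x j)" using z k by (auto simp: phi_subset_iff)
      then show ?thesis by (auto simp: R_def)
    next
      case False
      have "Y \<subseteq> \<phi> y"
      proof
        fix p assume p: "p \<in> Y"
        then have "p \<le> x k" using Y(2) z(2) k(2) unfolding isLub_UNIV_iff by (meson order_trans)
        then show "p \<in> \<phi> y" using in_y p Y(1) k(1) False by blast
      qed
      then have "\<phi> m \<subseteq> \<phi> y" using subset_phi_iff[OF YL Y(2)] by (simp add: phi_subset_iff)
      then show ?thesis using y by (auto simp: R_def)
    qed
  qed
  then have "quasiclosed Lir (range \<phi>) R" using quasiclosed_iff[OF RL] by blast
  moreover have "R \<notin> range \<phi>"
  proof
    assume "R \<in> range \<phi>"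
    then have Rl: "R = \<phi> l" using isLub_phi R isLub_UNIV_unique by (metis rangeE)
    \<comment> \<open>Since \<open>3 \<le> n\<close> there is a third index \<open>k\<close>;
      \<open>\<phi> l\<close> contains \<open>\<phi> (x k)\<close>, but \<open>R\<close> does
      not.\<close>
    have "card {i, j} < card {..<n}" using n by (simp add: card_insert_if)
    then have "\<not> {..<n} \<subseteq> {i, j}" by (meson card_mono finite.emptyI finite.insertI leD)
    then obtain k where k: "k < n" "k \<noteq> i" "k \<noteq> j" by auto
    have "\<phi> (x k) \<subseteq> R"
      unfolding Rl phi_subset_iff using cov(2)[OF k(1)] covered_by_less order_less_imp_le by blast
    then show False using cases k by blast
  qed
  ultimately show "properly_quasiclosed Lir (range \<phi>) R" by (simp add: properly_quasiclosed_def)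
qed

lemma M_element_lower_cover: "M_element n l x \<Longrightarrow> z \<prec> l \<Longrightarrow> \<exists>i<n. z = x i"
  unfolding M_element_def by (elim conjE allE impE) assumption+

text \<open>As \<open>l \<notin> Q\<close>, the set \<open>Q\<close> is down-closed and closed under
  every existing join other than \<open>l\<close>. Any existing join that leaves \<open>Q\<close>
  must therefore be \<open>l\<close> itself, which is used twice: for \<open>a \<squnion> b\<close>
  and for \<open>q \<squnion> r\<close>.\<close>

lemma properly_quasiclosed_contains_M_element:
  fixes Q :: "'a set"
  assumes pq: "properly_quasiclosed Lir (range \<phi>) Q" and l: "isLub UNIV Q l" "l \<notin> Q"
  obtains n x i j where "M_element n l x" "i < n" "j < n" "i \<noteq> j" "\<phi> (x i) \<union> \<phi> (x j) \<subseteq> Q"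
proof -
  have qc: "quasiclosed Lir (range \<phi>) Q" and ne: "Q \<notin> range \<phi>" and QL: "Q \<subseteq> Lir"
    using pq by (auto simp: properly_quasiclosed_def quasiclosed_def)
  have lub: "isLub UNIV Q m \<longleftrightarrow> m = l" for m using l(1) isLub_UNIV_unique by blast
  have Ql: "Q \<subseteq> \<phi> l" using subset_phi_iff[OF QL l(1)] by simp
  have down: "\<phi> p \<subseteq> Q" if "p \<in> Q" for p
    using quasiclosed_down[OF qc that] lub[of p] that l(2) by auto
  have join: "\<phi> (a \<squnion> b) \<subseteq> Q" if "\<phi> a \<subseteq> Q" "\<phi> b \<subseteq> Q" "has_join a b" "a \<squnion> b \<noteq> l" for a b
    using quasiclosed_pjoin[OF qc that(1-3)] lub that(4) by blast
  obtain m :: 'a where "is_minimum m" using ex_is_minimum by blast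
  then have "\<phi> m \<subseteq> Q" by (simp flip: phi_eq_empty_iff)
  \<comment> \<open>With \<open>a\<close> maximal, joining any further \<open>b \<in> Q\<close>
    leaves \<open>Q\<close>.\<close>
  then obtain a where a: "\<phi> a \<subseteq> Q" "\<And>z. \<phi> z \<subseteq> Q \<Longrightarrow> a \<le> z \<Longrightarrow> z = a"
    by (rule ex_maximal_ge[of "\<lambda>z. \<phi> z \<subseteq> Q"]) blast
  have "Q \<noteq> \<phi> a" using ne by blast
  then obtain b where b: "b \<in> Q" "b \<notin> \<phi> a" using a(1) by blast
  have "a \<le> l" using phi_subset_iff a(1) Ql by blast
  moreover have "b \<le> l" using b(1) Ql by (auto simp: \<phi>_def)
  ultimately have jab: "has_join a b" by (rule has_joinI)
  have "\<not> b \<le> a" using b QL by (auto simp: \<phi>_def)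
  then have "a \<squnion> b \<noteq> a" using pjoin_ge2[OF jab] by auto
  then have "\<not> \<phi> (a \<squnion> b) \<subseteq> Q" using a(2) pjoin_ge1[OF jab] by blast
  then have ab: "a \<squnion> b = l" using join[OF a(1) down[OF b(1)] jab] by blast
  have "\<phi> l \<noteq> Q" using ne by blast
  then obtain p where p: "p \<in> Lir" "p \<le> l" "p \<notin> Q" using Ql by (auto simp: \<phi>_def)
  have np: "\<not> p \<le> a" "\<not> p \<le> b" using p a(1) down[OF b(1)] by (auto simp: \<phi>_def)
  obtain q r where qr: "q \<in> Lir" "r \<in> Lir" "q \<le> a" "r \<le> b" "collinear q r p"
    using ex_collinear[OF p(1) p(2)[folded ab] np jab] .
  have jqr: "has_join q r" using jab qr(3,4) by (rule has_join_mono)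
  have Q: "\<phi> q \<subseteq> Q" "\<phi> r \<subseteq> Q"
    using qr(3,4) a(1) down[OF b(1)] phi_subset_iff subset_trans by blast+
  have nqr: "\<not> q \<le> r" "\<not> r \<le> q" using qr(5) by (auto simp: collinear_def incomparable_def)
  obtain s where "isLub UNIV {q, r} s" "isLub UNIV {r, p} s"
    using qr(5) unfolding collinear_def by blast
  then have "p \<le> q \<squnion> r" using pjoin_ge2[of r p] by (auto simp: isLub_iff_pjoin)
  then have "\<not> \<phi> (q \<squnion> r) \<subseteq> Q" using p by (auto simp: \<phi>_def)
  then have qrl: "q \<squnion> r = l" using join[OF Q jqr] by blast
  obtain n x where M: "M_element n l x"
    using M_element_if_collinear[OF p(1) qr(1,2,5)] qrl by blast
  \<comment> \<open>Replacing \<open>q\<close> or \<open>r\<close> by its lower cover gives two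
    lower covers of \<open>l\<close>; as joins different from \<open>l\<close>, they keep their
    irreducibles inside \<open>Q\<close>.\<close>
  define u where "u = lower_cover q \<squnion> r"
  define v where "v = lower_cover r \<squnion> q"
  have u: "u \<prec> l" unfolding u_def qrl[symmetric]
    by (rule covered_by_pjoin_lower_cover[OF qr(1) jqr nqr(1)])
  have v: "v \<prec> l" unfolding v_def qrl[symmetric] pjoin_commute[of q r]
    by (rule covered_by_pjoin_lower_cover[OF qr(2) _ nqr(2)]) (simp add: jqr has_join_commute)
  have lc: "\<phi> (lower_cover q) \<subseteq> Q" "\<phi> (lower_cover r) \<subseteq> Q"
    using Q qr(1,2) lower_cover_le phi_subset_iff subset_trans by blast+
  have jl: "has_join (lower_cover q) r" "has_join (lower_cover r) q"
    using jqr qr(1,2) lower_cover_le has_join_commute has_join_mono order_refl by metis+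
  have "r \<le> u" "q \<le> v" unfolding u_def v_def using jl by (simp_all add: pjoin_ge2)
  then have "u \<noteq> v" using u qrl pjoin_least[of q u r] covered_by_less[OF u] by (auto dest: leD)
  have "\<phi> u \<subseteq> Q" unfolding u_def
    by (rule join) (use lc Q jl covered_by_less[OF u] u_def in auto)
  moreover have "\<phi> v \<subseteq> Q" unfolding v_def
    by (rule join) (use lc Q jl covered_by_less[OF v] v_def in auto)
  moreover obtain i j where "i < n" "u = x i" "j < n" "v = x j"
    using M_element_lower_cover[OF M u] M_element_lower_cover[OF M v] by blast
  ultimately show thesis using that[OF M, of i j] \<open>u \<noteq> v\<close> by auto
qed

section \<open>Minimal inconsistent pairs\<close>

text \<open>By minimality every irreducible below \<open>lower_cover x\<close> is consistent with
  \<open>y\<close>, hence so is \<open>lower_cover x\<close>, and symmetrically. The coverings come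
  from \<open>covered_by_pjoin_lower_cover\<close>; a bound of \<open>a\<close> and \<open>b\<close>
  would bound \<open>x\<close> and \<open>y\<close>.\<close>

lemma minimal_inconsistent_pair_covers:
  fixes x y :: 'a
  assumes mip: "minimal_inconsistent_pair x y"
  defines "a \<equiv> x \<squnion> lower_cover y" and "b \<equiv> lower_cover x \<squnion> y"
    and "m \<equiv> lower_cover x \<squnion> lower_cover y"
  shows "has_join x (lower_cover y)" "has_join (lower_cover x) y"
    and "m \<prec> a" "m \<prec> b" "\<not> has_join a b"
proof -
  have xy: "x \<in> Lir" "y \<in> Lir" "\<not> has_join x y"
    and min: "\<And>x' y'. x' \<in> Lir \<Longrightarrow> y' \<in> Lir \<Longrightarrow> x' \<le> x \<Longrightarrow> y' \<le> y \<Longrightarrow> \<not> has_join x' y' \<Longrightarrow> x' = x \<and> y' = y"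
    using mip unfolding minimal_inconsistent_pair_def inconsistent_def by blast+
  have not_x: "\<not> x \<le> lower_cover x" and not_y: "\<not> y \<le> lower_cover y"
    using covered_by_less[OF lower_cover_covered[OF xy(1)]]
      covered_by_less[OF lower_cover_covered[OF xy(2)]] by auto
  have "has_join p y" if "p \<in> \<phi> (lower_cover x)" for p
  proof (rule ccontr)
    assume "\<not> has_join p y"
    moreover have "p \<in> Lir" "p \<le> lower_cover x" "p \<le> x"
      using that lower_cover_le[OF xy(1)] by (auto simp: \<phi>_def)
    ultimately have "p = x" using min xy(2) by blast
    then show False using \<open>p \<le> lower_cover x\<close> not_x by simp
  qed
  then show jb: "has_join (lower_cover x) y" by (rule has_join_phi)
  have "has_join p x" if "p \<in> \<phi> (lower_cover y)" for p
  proof (rule ccontr)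
    assume "\<not> has_join p x"
    moreover have "p \<in> Lir" "p \<le> lower_cover y" "p \<le> y"
      using that lower_cover_le[OF xy(2)] by (auto simp: \<phi>_def)
    ultimately have "p = y" using min xy(1) has_join_commute by blast
    then show False using \<open>p \<le> lower_cover y\<close> not_y by simp
  qed
  then have "has_join (lower_cover y) x" by (rule has_join_phi)
  then show ja: "has_join x (lower_cover y)" by (simp add: has_join_commute)
  have "\<not> x \<le> lower_cover y" "\<not> y \<le> lower_cover x"
    using xy lower_cover_le has_joinI[of x y y] has_joinI[of x x y] order_trans by blast+
  then show "m \<prec> a" "m \<prec> b"
    using covered_by_pjoin_lower_cover[OF xy(1) ja]
      covered_by_pjoin_lower_cover[OF xy(2), of "lower_cover x"] jb
    unfolding a_def b_def m_def by (simp_all add: pjoin_commute has_join_commute)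
  show "\<not> has_join a b"
    using xy(3) has_join_mono[of a b x y] pjoin_ge1[OF ja] pjoin_ge2[OF jb] by (auto simp: a_def b_def)
qed

text \<open>A bounded subset lies on one side. For \<open>p\<close> not below \<open>b\<close> and
  \<open>q\<close> not below \<open>a\<close>, a bound of \<open>p\<close> and \<open>q\<close>
  would yield one of \<open>p\<close>, \<open>q\<close>, \<open>m\<close>, hence of
  \<open>p \<squnion> m = a\<close> and \<open>q \<squnion> m = b\<close>.\<close>

lemma quasiclosed_phi_Un:
  fixes a b m :: 'a
  assumes cov: "m \<prec> a" "m \<prec> b" and inc: "\<not> has_join a b"
  shows "quasiclosed Lir (range \<phi>) (\<phi> a \<union> \<phi> b)"
proof -
  have le: "m \<le> a" "m \<le> b" using covered_by_less[OF cov(1)] covered_by_less[OF cov(2)] by auto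
  have "\<phi> s \<subseteq> \<phi> a \<union> \<phi> b" if Y: "Y \<subseteq> \<phi> a \<union> \<phi> b" "isLub UNIV Y s" for Y s
  proof -
    have YL: "Y \<subseteq> Lir" using Y(1) phi_subset_Lir by blast
    have "Y \<subseteq> \<phi> a \<or> Y \<subseteq> \<phi> b"
    proof (rule ccontr)
      assume "\<not> ?thesis"
      then obtain p q where pq: "p \<in> Y" "q \<in> Y" "\<not> p \<le> b" "\<not> q \<le> a"
        using YL by (auto simp: \<phi>_def)
      then have "p \<le> a" "q \<le> b" using Y(1) by (auto simp: \<phi>_def)
      have "has_join p q" using pq(1,2) Y(2) has_joinI[of p s q] by (simp add: isLub_UNIV_iff)
      moreover have "has_join q m" "has_join p m"
        using \<open>p \<le> a\<close> \<open>q \<le> b\<close> le by (auto intro: has_joinI)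
      ultimately obtain t where t: "p \<le> t" "q \<le> t" "m \<le> t" by (rule has_join3)
      have "\<not> p \<le> m" "\<not> q \<le> m" using pq(3,4) le order_trans by blast+
      then have "p \<squnion> m = a" "q \<squnion> m = b"
        using covered_by_pjoin cov \<open>p \<le> a\<close> \<open>q \<le> b\<close> by blast+
      then have "a \<le> t" "b \<le> t" using t pjoin_least by blast+
      then show False using inc has_joinI by blast
    qed
    then have "s \<le> a \<or> s \<le> b" using subset_phi_iff[OF YL Y(2)] by blast
    then show ?thesis using phi_subset_iff by blast
  qed
  then show ?thesis using quasiclosed_iff[of "\<phi> a \<union> \<phi> b"] phi_subset_Lir by blast
qed

text \<open>Because \<open>m \<prec> a\<close>, any irreducible below \<open>a\<close> but not below
  \<open>m\<close> can take over the role of \<open>x\<close>. Keeping \<open>a\<close>,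
  \<open>b\<close> and \<open>m\<close> unchanged allows a second exchange on the other
  side.\<close>

lemma minimal_inconsistent_pair_exchange:
  fixes x y p :: 'a
  assumes mip: "minimal_inconsistent_pair x y"
    and p: "p \<in> Lir" "p \<le> x \<squnion> lower_cover y" "\<not> p \<le> lower_cover x \<squnion> lower_cover y"
  shows "minimal_inconsistent_pair p y"
    and "p \<squnion> lower_cover y = x \<squnion> lower_cover y"
    and "lower_cover p \<squnion> y = lower_cover x \<squnion> y"
    and "lower_cover p \<squnion> lower_cover y = lower_cover x \<squnion> lower_cover y"
proof -
  define a where "a = x \<squnion> lower_cover y"
  define b where "b = lower_cover x \<squnion> y"
  define m where "m = lower_cover x \<squnion> lower_cover y"
  note cov = minimal_inconsistent_pair_covers[OF mip, folded a_def b_def m_def]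
  have xy: "x \<in> Lir" "y \<in> Lir" using mip by (auto simp: minimal_inconsistent_pair_def)
  note lcx = lower_cover_le[OF xy(1)] and lcy = lower_cover_le[OF xy(2)]
  have jm: "has_join (lower_cover x) (lower_cover y)"
    using has_join_mono[OF cov(1) lcx order_refl] .
  have le: "m \<le> a" "m \<le> b" "y \<le> b" "lower_cover y \<le> m" "lower_cover x \<le> m" "lower_cover y \<le> a"
    using covered_by_less[OF cov(3)] covered_by_less[OF cov(4)] pjoin_ge2[OF cov(2)]
      pjoin_ge2[OF jm] pjoin_ge1[OF jm] pjoin_ge2[OF cov(1)]
    by (auto simp: a_def b_def m_def)
  have pa: "p \<le> a" and pm: "\<not> p \<le> m" using p(2,3) by (auto simp: a_def m_def)
  have lpm: "lower_cover p \<le> m" using lower_cover_le_covered[OF p(1) pa cov(3)] .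
  have inc: "\<not> has_join p y"
  proof
    assume "has_join p y"
    moreover have "has_join y m" "has_join p m" using le pa by (auto intro: has_joinI)
    ultimately obtain t where t: "p \<le> t" "y \<le> t" "m \<le> t" by (rule has_join3)
    have "a \<le> t" using covered_by_pjoin[OF cov(3) pa pm] t pjoin_least by blast
    moreover have "b \<le> t" unfolding b_def using t le(5) by (intro pjoin_least) auto
    ultimately show False using cov(5) has_joinI by blast
  qed
  have "p' = p \<and> y' = y"
    if h: "p' \<in> Lir" "y' \<in> Lir" "p' \<le> p" "y' \<le> y" "\<not> has_join p' y'" for p' y'
  \<comment> \<open>A properly smaller \<open>p'\<close> lies below \<open>m \<le> b\<close> and so
    is bounded by \<open>b\<close> together with \<open>y'\<close>; a properly smaller
    \<open>y'\<close> is bounded by \<open>a\<close> together with \<open>p'\<close>.\<close>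
  proof (intro conjI; rule ccontr)
    assume "p' \<noteq> p"
    then have "p' \<le> b"
      using less_imp_le_lower_cover[OF p(1), of p'] h(3) lpm le(2) by (auto simp: order_less_le)
    then show False using h(4,5) le(3) has_joinI[of p' b y'] by auto
  next
    assume "y' \<noteq> y"
    then have "y' \<le> a"
      using less_imp_le_lower_cover[OF xy(2), of y'] h(4) le(6) by (auto simp: order_less_le)
    then show False using h(3,5) pa has_joinI[of p' a y'] by auto
  qed
  then show "minimal_inconsistent_pair p y"
    using p(1) xy(2) inc unfolding minimal_inconsistent_pair_def inconsistent_def by blast
  define z where "z = p \<squnion> lower_cover y"
  have jz: "has_join p (lower_cover y)" using pa le(6) by (rule has_joinI)
  have za: "z \<le> a" unfolding z_def using pa le(6) by (rule pjoin_least)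
  have yz: "lower_cover y \<le> z" unfolding z_def by (rule pjoin_ge2[OF jz])
  \<comment> \<open>Otherwise \<open>x \<sqinter> z \<le> lower_cover x\<close>, and the modular law
    would place \<open>z\<close>, and with it \<open>p\<close>, below \<open>m\<close>.\<close>
  have "x \<le> z"
  proof (rule ccontr)
    assume "\<not> x \<le> z"
    then have "x \<sqinter> z \<le> lower_cover x"
      using less_imp_le_lower_cover[OF xy(1)] by (simp add: inf_less_iff)
    then have "lower_cover y \<squnion> (x \<sqinter> z) \<le> m" using le by (intro pjoin_least) auto
    moreover have "lower_cover y \<squnion> (x \<sqinter> z) = (lower_cover y \<squnion> x) \<sqinter> z"
      using cov(1) yz by (intro modular_law) (auto simp: has_join_commute)
    moreover have "\<dots> = z" using za by (simp add: a_def pjoin_commute inf.absorb2)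
    ultimately show False using pm pjoin_ge1[OF jz] by (auto simp: z_def)
  qed
  then have "a \<le> z" unfolding a_def using yz by (rule pjoin_least)
  then have z: "z = a" using za by simp
  then show "p \<squnion> lower_cover y = x \<squnion> lower_cover y" by (simp add: z_def a_def)
  have "\<not> p \<le> lower_cover y" using pm le(4) by auto
  then have "lower_cover p \<squnion> lower_cover y \<prec> a"
    using covered_by_pjoin_lower_cover[OF p(1) jz] z by (simp add: z_def)
  moreover have "lower_cover p \<squnion> lower_cover y \<le> m" using lpm le(4) by (rule pjoin_least)
  \<comment> \<open>Both elements are covered by \<open>a\<close>, so comparability makes them
    equal.\<close>
  ultimately have lpy: "lower_cover p \<squnion> lower_cover y = m"
    using covered_by_antichain cov(3) by blast
  then show "lower_cover p \<squnion> lower_cover y = lower_cover x \<squnion> lower_cover y" by (simp add: m_def)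
  have jpy: "has_join (lower_cover p) y" using lpm le(2,3) by (auto intro: has_joinI[of _ b])
  have "m \<le> lower_cover p \<squnion> y"
    unfolding lpy[symmetric] using pjoin_ge1[OF jpy] pjoin_ge2[OF jpy] lcy
    by (intro pjoin_least) auto
  then have "b \<le> lower_cover p \<squnion> y"
    unfolding b_def using pjoin_ge2[OF jpy] le(5) by (intro pjoin_least) auto
  moreover have "lower_cover p \<squnion> y \<le> b" using lpm le by (intro pjoin_least) auto
  ultimately show "lower_cover p \<squnion> y = lower_cover x \<squnion> y" by (simp add: b_def)
qed

lemma ex_inconsistent:
  fixes R :: "'a set"
  assumes "R \<subseteq> Lir" "clos (range \<phi>) R = None"
  obtains p q where "p \<in> R" "q \<in> R" "\<not> has_join p q"
proof -
  have "\<not> (\<exists>u. \<forall>x\<in>R. x \<le> u)" using clos_eq_None_iff assms by blast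
  then have "\<not> (\<forall>p\<in>R. \<forall>q\<in>R. has_join p q)" using pairwise_bounded by metis
  then show thesis using that by blast
qed

text \<open>\<open>R\<close> has no join, so quasiclosedness exempts nothing:
  \<open>\<phi> x\<close> and \<open>\<phi> y\<close> lie in \<open>R\<close>, and so does
  \<open>\<phi>\<close> of the two joins with lower covers.\<close>

lemma quasiclosed_superset:
  fixes R :: "'a set"
  assumes mip: "minimal_inconsistent_pair x y" and qc: "quasiclosed Lir (range \<phi>) R"
    and R: "x \<in> R" "y \<in> R"
  shows "\<phi> (x \<squnion> lower_cover y) \<union> \<phi> (lower_cover x \<squnion> y) \<subseteq> R"
proof -
  have xy: "x \<in> Lir" "y \<in> Lir" "\<not> has_join x y"
    using mip by (auto simp: minimal_inconsistent_pair_def inconsistent_def)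
  have no_lub: "\<not> isLub UNIV R l" for l
    using R xy(3) has_joinI[of x l y] by (auto simp: isLub_UNIV_iff)
  have xR: "\<phi> x \<subseteq> R" and yR: "\<phi> y \<subseteq> R" using quasiclosed_down[OF qc] R no_lub by blast+
  then have "\<phi> (lower_cover x) \<subseteq> R" "\<phi> (lower_cover y) \<subseteq> R"
    using xy lower_cover_le phi_subset_iff subset_trans by blast+
  then show ?thesis
    using quasiclosed_pjoin[OF qc] minimal_inconsistent_pair_covers(1,2)[OF mip] no_lub xR yR by blast
qed

lemma qclos_minimal_inconsistent_pair:
  fixes x y :: 'a
  assumes mip: "minimal_inconsistent_pair x y"
  shows "qclos Lir (range \<phi>) (\<phi> x \<union> \<phi> y) = \<phi> (x \<squnion> lower_cover y) \<union> \<phi> (lower_cover x \<squnion> y)"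
  unfolding qclos_def
proof (rule Least_equality)
  note cov = minimal_inconsistent_pair_covers[OF mip]
  have "\<phi> x \<subseteq> \<phi> (x \<squnion> lower_cover y)" "\<phi> y \<subseteq> \<phi> (lower_cover x \<squnion> y)"
    unfolding phi_subset_iff using cov(1,2) by (simp_all add: pjoin_ge1 pjoin_ge2)
  then show "quasiclosed Lir (range \<phi>) (\<phi> (x \<squnion> lower_cover y) \<union> \<phi> (lower_cover x \<squnion> y)) \<and>
      \<phi> x \<union> \<phi> y \<subseteq> \<phi> (x \<squnion> lower_cover y) \<union> \<phi> (lower_cover x \<squnion> y)"
    using quasiclosed_phi_Un[OF cov(3-5)] by blast
next
  fix R assume R: "quasiclosed Lir (range \<phi>) R \<and> \<phi> x \<union> \<phi> y \<subseteq> R"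
  have "x \<in> \<phi> x" "y \<in> \<phi> y" using mip by (auto simp: minimal_inconsistent_pair_def \<phi>_def)
  then show "\<phi> (x \<squnion> lower_cover y) \<union> \<phi> (lower_cover x \<squnion> y) \<subseteq> R"
    using quasiclosed_superset[OF mip] R by blast
qed

text \<open>An inconsistent pair \<open>p\<close>, \<open>q\<close> in \<open>R\<close> has one
  entry below \<open>a\<close> and the other below \<open>b\<close>. Exchanging \<open>x\<close> for
  \<open>p\<close> and then, in the flipped pair, \<open>y\<close> for \<open>q\<close> leaves
  \<open>a\<close> and \<open>b\<close> fixed, and \<open>quasiclosed_superset\<close> applies to
  the new pair.\<close>

lemma unbounded_quasiclosed_subset:
  fixes R :: "'a set"
  assumes mip: "minimal_inconsistent_pair x y" and qc: "quasiclosed Lir (range \<phi>) R"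
    and unb: "clos (range \<phi>) R = None"
    and sub: "R \<subseteq> \<phi> (x \<squnion> lower_cover y) \<union> \<phi> (lower_cover x \<squnion> y)"
  shows "R = \<phi> (x \<squnion> lower_cover y) \<union> \<phi> (lower_cover x \<squnion> y)"
proof -
  define a where "a = x \<squnion> lower_cover y"
  define b where "b = lower_cover x \<squnion> y"
  define m where "m = lower_cover x \<squnion> lower_cover y"
  note cov = minimal_inconsistent_pair_covers[OF mip, folded a_def b_def m_def]
  have le: "m \<le> a" "m \<le> b" using covered_by_less[OF cov(3)] covered_by_less[OF cov(4)] by auto
  have RL: "R \<subseteq> Lir" using qc by (simp add: quasiclosed_def)
  then obtain p q where pq: "p \<in> R" "q \<in> R" "\<not> has_join p q"
    using unb by (rule ex_inconsistent)
  obtain p q where pq: "p \<in> R" "q \<in> R" "\<not> has_join p q" "p \<le> a" "q \<le> b"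
  proof -
    have "p \<le> a \<or> p \<le> b" "q \<le> a \<or> q \<le> b" using pq sub by (auto simp: \<phi>_def a_def b_def)
    moreover have "\<not> (p \<le> a \<and> q \<le> a)" "\<not> (p \<le> b \<and> q \<le> b)" using pq(3) has_joinI by blast+
    moreover have "\<not> has_join q p" using pq(3) by (simp add: has_join_commute)
    ultimately show thesis using that pq by blast
  qed
  have irr: "p \<in> Lir" "q \<in> Lir" using pq RL by auto
  have "\<not> p \<le> m" "\<not> q \<le> m"
    using pq(3-5) le has_joinI[of p b q] has_joinI[of p a q] order_trans by blast+
  then have nm: "\<not> p \<le> lower_cover x \<squnion> lower_cover y" "\<not> q \<le> m" by (simp_all add: m_def)
  note px = minimal_inconsistent_pair_exchange[OF mip irr(1) pq(4)[unfolded a_def] nm(1)]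
  have "minimal_inconsistent_pair y p" using px(1) minimal_inconsistent_pair_commute by blast
  moreover have "q \<le> y \<squnion> lower_cover p" using pq(5) px(3) by (simp add: b_def pjoin_commute)
  moreover have "\<not> q \<le> lower_cover y \<squnion> lower_cover p"
    using nm(2) px(4) by (simp add: m_def pjoin_commute)
  ultimately have qp: "minimal_inconsistent_pair q p" "q \<squnion> lower_cover p = y \<squnion> lower_cover p"
    "lower_cover q \<squnion> p = lower_cover y \<squnion> p"
    using minimal_inconsistent_pair_exchange irr(2) by blast+
  have "\<phi> (q \<squnion> lower_cover p) \<union> \<phi> (lower_cover q \<squnion> p) \<subseteq> R"
    by (rule quasiclosed_superset[OF qp(1) qc pq(2,1)])
  moreover have "q \<squnion> lower_cover p = b" "lower_cover q \<squnion> p = a"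
    using qp(2,3) px(2,3) by (simp_all add: a_def b_def pjoin_commute)
  ultimately show ?thesis using sub by (auto simp: a_def b_def)
qed

section \<open>Pseudoclosed sets\<close>

text \<open>The only proper subset is empty and belongs to the family as \<open>\<phi>\<close> of
  the minimum; \<open>{q}\<close> could only be \<open>\<phi> q\<close>, which is larger for
  nonatomic \<open>q\<close>.\<close>

lemma pseudoclosed_singleton:
  fixes q :: 'a
  assumes q: "q \<in> Lir" "nonatomic q"
  shows "pseudoclosed Lir (range \<phi>) {q}"
proof -
  have empty: "{} \<in> range (\<phi> :: 'a \<Rightarrow> _)"
    using ex_is_minimum phi_eq_empty_iff by (metis rangeI)
  have "isLub UNIV {q} q" by (simp add: isLub_UNIV_iff)
  have "\<phi> m \<subseteq> {q}" if "Y \<subseteq> {q}" "isLub UNIV Y m" "\<not> isLub UNIV {q} m" for Y m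
  proof -
    have "Y = {}" using that by (auto simp: subset_singleton_iff)
    then have "is_minimum m" using that(2) by (simp add: isLub_UNIV_iff is_minimum_def)
    then show ?thesis by (simp flip: phi_eq_empty_iff)
  qed
  then have "quasiclosed Lir (range \<phi>) {q}" using quasiclosed_iff[of "{q}"] q(1) by simp
  moreover have "{q} \<notin> range \<phi>"
  proof
    assume "{q} \<in> range \<phi>"
    then obtain l where l: "{q} = \<phi> l" by auto
    then have "l = q" using isLub_phi[of l] \<open>isLub UNIV {q} q\<close> isLub_UNIV_unique by metis
    then show False using nonatomic_iff q l by blast
  qed
  ultimately show ?thesis
    unfolding pseudoclosed_def properly_quasiclosed_def using empty by (auto simp: subset_singleton_iff)
qed

text \<open>A properly quasiclosed \<open>Q\<close> inside the union with the same closure contains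
  \<open>\<phi>\<close> of two lower covers of \<open>l\<close>. These are among the
  \<open>x k\<close>, and only the indices \<open>i\<close> and \<open>j\<close> fit into the
  union.\<close>

lemma pseudoclosed_M_element:
  fixes l :: 'a
  assumes M: "M_element n l x" and ij: "i < n" "j < n" "i \<noteq> j"
  shows "pseudoclosed Lir (range \<phi>) (\<phi> (x i) \<union> \<phi> (x j))"
  unfolding pseudoclosed_def
proof (intro conjI allI impI)
  let ?R = "\<phi> (x i) \<union> \<phi> (x j)"
  note R = M_element_quasiclosed[OF M ij]
  show "properly_quasiclosed Lir (range \<phi>) ?R" by (rule R(3))
  fix Q assume Q: "properly_quasiclosed Lir (range \<phi>) Q" "clos (range \<phi>) Q = clos (range \<phi>) ?R" "Q \<subseteq> ?R"
  have QL: "Q \<subseteq> Lir" using Q(3) R(1) by blast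
  have cl: "clos (range \<phi>) Q = Some (\<phi> l)" using Q(2) clos_isLub[OF R(1,2)] by simp
  then obtain u where "\<forall>z\<in>Q. z \<le> u" using clos_eq_None_iff[OF QL] by auto
  then obtain l' where l': "isLub UNIV Q l'" by (rule ex_isLub)
  then have "l' = l" using clos_isLub[OF QL l'] cl by (simp add: phi_eq_iff)
  then have lub: "isLub UNIV Q l" using l' by simp
  have "l \<notin> Q" using R(4) Q(3) by blast
  then obtain n' x' i' j' where M': "M_element n' l x'" "i' < n'" "j' < n'" "i' \<noteq> j'"
    and sub: "\<phi> (x' i') \<union> \<phi> (x' j') \<subseteq> Q"
    by (rule properly_quasiclosed_contains_M_element[OF Q(1) lub])
  have "isLub UNIV {x' i', x' j'} l" "x' i' \<prec> l" "x' j' \<prec> l"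
    using M' unfolding M_element_def by blast+
  \<comment> \<open>Equal elements would have themselves as join, not \<open>l\<close>.\<close>
  then have ne: "x' i' \<noteq> x' j'"
    using covered_by_less[of "x' i'" l] by (auto simp: isLub_UNIV_iff dest: leD)
  obtain k k' where k: "k < n" "x' i' = x k" "k' < n" "x' j' = x k'"
    using M_element_lower_cover[OF M \<open>x' i' \<prec> l\<close>] M_element_lower_cover[OF M \<open>x' j' \<prec> l\<close>]
    by blast
  have "\<phi> (x k) \<subseteq> ?R" "\<phi> (x k') \<subseteq> ?R" using sub Q(3) k by auto
  then have "k = i \<or> k = j" "k' = i \<or> k' = j" using R(5) k by blast+
  then have "?R \<subseteq> Q" using sub ne k by auto
  then show "Q = ?R" using Q(3) by blast
qed

lemma pseudoclosed_minimal_inconsistent_pair: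
  fixes x y :: 'a
  assumes mip: "minimal_inconsistent_pair x y"
  shows "pseudoclosed Lir (range \<phi>) (\<phi> (x \<squnion> lower_cover y) \<union> \<phi> (lower_cover x \<squnion> y))"
    and "clos (range \<phi>) (\<phi> (x \<squnion> lower_cover y) \<union> \<phi> (lower_cover x \<squnion> y)) = None"
proof -
  let ?R = "\<phi> (x \<squnion> lower_cover y) \<union> \<phi> (lower_cover x \<squnion> y)"
  note cov = minimal_inconsistent_pair_covers[OF mip]
  have xy: "x \<in> Lir" "y \<in> Lir" "\<not> has_join x y"
    using mip by (auto simp: minimal_inconsistent_pair_def inconsistent_def)
  have RL: "?R \<subseteq> Lir" using phi_subset_Lir by blast
  have "x \<in> ?R" "y \<in> ?R" using xy cov(1,2) by (simp_all add: \<phi>_def pjoin_ge1 pjoin_ge2)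
  then show none: "clos (range \<phi>) ?R = None"
    unfolding clos_eq_None_iff[OF RL] using xy(3) has_joinI by blast
  have "?R \<notin> range \<phi>" using none by (auto simp: clos_def split: if_splits)
  then have "properly_quasiclosed Lir (range \<phi>) ?R"
    using quasiclosed_phi_Un[OF cov(3-5)] by (simp add: properly_quasiclosed_def)
  moreover have "Q = ?R"
    if "properly_quasiclosed Lir (range \<phi>) Q" "clos (range \<phi>) Q = clos (range \<phi>) ?R" "Q \<subseteq> ?R" for Q
    using that none by (intro unbounded_quasiclosed_subset[OF mip]) (simp_all add: properly_quasiclosed_def)
  ultimately show "pseudoclosed Lir (range \<phi>) ?R" unfolding pseudoclosed_def by blast
qed

text \<open>In each case \<open>P\<close> contains a properly quasiclosed set of the listed form
  with an equivalent closure, so minimality forces equality.\<close>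

lemma pseudoclosed_cases:
  fixes P :: "'a set"
  assumes P: "pseudoclosed Lir (range \<phi>) P"
  obtains (singleton) q where "q \<in> Lir" "nonatomic q" "P = {q}"
  | (M_element) n l x i j where "M_element n l x" "i < n" "j < n" "i \<noteq> j" "P = \<phi> (x i) \<union> \<phi> (x j)"
  | (inconsistent) x y where "minimal_inconsistent_pair x y"
      "P = \<phi> (x \<squnion> lower_cover y) \<union> \<phi> (lower_cover x \<squnion> y)"
proof -
  have pq: "properly_quasiclosed Lir (range \<phi>) P"
    and min: "\<And>Q. properly_quasiclosed Lir (range \<phi>) Q \<Longrightarrow> clos (range \<phi>) Q = clos (range \<phi>) P \<Longrightarrow> Q \<subseteq> P \<Longrightarrow> Q = P"
    using P unfolding pseudoclosed_def by auto
  have qc: "quasiclosed Lir (range \<phi>) P" and ne: "P \<notin> range \<phi>" and PL: "P \<subseteq> Lir"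
    using pq by (auto simp: properly_quasiclosed_def quasiclosed_def)
  show thesis
  proof (cases "clos (range \<phi>) P = None")
    case True
    obtain p q where pq: "p \<in> P" "q \<in> P" "\<not> has_join p q"
      using ex_inconsistent[OF PL True] .
    have no_lub: "\<not> isLub UNIV P l" for l
      using pq has_joinI[of p l q] by (auto simp: isLub_UNIV_iff)
    have "p \<in> Lir" "q \<in> Lir" using pq PL by auto
    then obtain x y where mip: "minimal_inconsistent_pair x y" "x \<le> p" "y \<le> q"
      using ex_minimal_inconsistent_pair pq(3) by blast
    then have "x \<in> \<phi> p" "y \<in> \<phi> q" by (auto simp: minimal_inconsistent_pair_def \<phi>_def)
    then have "x \<in> P" "y \<in> P" using quasiclosed_down[OF qc] pq no_lub by blast+
    then have "\<phi> (x \<squnion> lower_cover y) \<union> \<phi> (lower_cover x \<squnion> y) \<subseteq> P"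
      by (rule quasiclosed_superset[OF mip(1) qc])
    then have "\<phi> (x \<squnion> lower_cover y) \<union> \<phi> (lower_cover x \<squnion> y) = P"
      using min pseudoclosed_minimal_inconsistent_pair[OF mip(1)] True
      by (simp add: pseudoclosed_def)
    then show ?thesis using inconsistent[OF mip(1)] by simp
  next
    case False
    then obtain u where "\<forall>z\<in>P. z \<le> u" using clos_eq_None_iff[OF PL] by auto
    then obtain l where l: "isLub UNIV P l" by (rule ex_isLub)
    have cl: "clos (range \<phi>) P = Some (\<phi> l)" using clos_isLub[OF PL l] .
    show ?thesis
    proof (cases "l \<in> P")
      case True
      then have irr: "l \<in> Lir" using PL by auto
      have "P \<subseteq> \<phi> l" using subset_phi_iff[OF PL l] by simp
      \<comment> \<open>Otherwise \<open>P\<close>, squeezed between \<open>{l}\<close> and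
        \<open>\<phi> l\<close>, would belong to the family.\<close>
      then have "\<phi> l \<noteq> {l}" using True ne by (metis empty_iff rangeI subset_singletonD)
      then have "nonatomic l" by (simp add: nonatomic_iff[OF irr])
      moreover have "{l} = P"
      proof (rule min)
        show "properly_quasiclosed Lir (range \<phi>) {l}"
          using pseudoclosed_singleton[OF irr \<open>nonatomic l\<close>] by (simp add: pseudoclosed_def)
        show "clos (range \<phi>) {l} = clos (range \<phi>) P"
          using clos_isLub[of "{l}" l] irr cl by (simp add: isLub_UNIV_iff)
      qed (use True in simp)
      ultimately show ?thesis using singleton irr by blast
    next
      case notin: False
      obtain n x i j where M: "M_element n l x" "i < n" "j < n" "i \<noteq> j" "\<phi> (x i) \<union> \<phi> (x j) \<subseteq> P"
        using properly_quasiclosed_contains_M_element[OF pq l notin] .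
      note R = M_element_quasiclosed[OF M(1-4)]
      have "\<phi> (x i) \<union> \<phi> (x j) = P"
        using min[OF R(3) _ M(5)] clos_isLub[OF R(1,2)] cl by simp
      then show ?thesis using M_element[OF M(1-4)] by simp
    qed
  qed
qed

end

theorem theorem4p7:
  fixes F :: "'a::{finite, semilattice_inf} set set"
  assumes "modular_semilattice TYPE('a)"
    and "F = consistent_subspaces"
  shows "{P. pseudoclosed Lir F P} =
      {{q} | q. q \<in> Lir \<and> nonatomic q}
    \<union> {\<phi> (x i) \<union> \<phi> (x j) | l n x i j. M_element n l x \<and> i < j \<and> j < n}
    \<union> {qclos Lir F (\<phi> x \<union> \<phi> y) | x y. minimal_inconsistent_pair x y}"
    (is "?P = ?A \<union> ?B \<union> ?C")
proof -
  interpret finite_modular_semilattice "TYPE('a)" by standard (rule assms(1))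
  have F: "F = range \<phi>" using assms(2) consistent_subspaces_eq by simp
  show ?thesis
  proof (intro set_eqI iffI)
    fix P assume "P \<in> ?P"
    then have "pseudoclosed Lir (range \<phi>) P" by (simp add: F)
    then show "P \<in> ?A \<union> ?B \<union> ?C"
    proof (cases rule: pseudoclosed_cases)
      case (singleton q)
      then show ?thesis by blast
    next
      case (M_element n l x i j)
      then have "P \<in> ?B"
      \<comment> \<open>The union is symmetric in its indices, so they can be put in increasing
        order.\<close>
      proof (cases "i < j")
        case False
        then have "j < i" "P = \<phi> (x j) \<union> \<phi> (x i)" using M_element by auto
        then show ?thesis using M_element by blast
      qed blast
      then show ?thesis by blast
    next
      case (inconsistent x y)
      then have "P = qclos Lir F (\<phi> x \<union> \<phi> y)"
        by (simp add: F qclos_minimal_inconsistent_pair)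
      then show ?thesis using inconsistent(1) by blast
    qed
  next
    fix P assume "P \<in> ?A \<union> ?B \<union> ?C"
    then consider "P \<in> ?A" | "P \<in> ?B" | "P \<in> ?C" by blast
    then have "pseudoclosed Lir F P"
    proof cases
      case 1
      then show ?thesis unfolding F using pseudoclosed_singleton by blast
    next
      case 2
      then obtain l n x i j where "P = \<phi> (x i) \<union> \<phi> (x j)" "M_element n l x" "i < j" "j < n" by blast
      then show ?thesis unfolding F using pseudoclosed_M_element[of n l x i j] by simp
    next
      case 3
      then obtain x y where xy: "minimal_inconsistent_pair x y" "P = qclos Lir F (\<phi> x \<union> \<phi> y)"
        by blast
      then show ?thesis
        unfolding F
        using pseudoclosed_minimal_inconsistent_pair(1)[OF xy(1)] qclos_minimal_inconsistent_pair[OF xy(1)]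
        by simp
    qed
    then show "P \<in> ?P" by simp
  qed
qed

end
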